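(* The Plancherel measure $\mathfrak m^{\mathrm{bd}}$ of the edge enlightening random walk with law $\widetilde\mu_{\mathrm{bd}}$ on $\mathcal L^{\mathrm{bd}}\rtimes G$ and the integrated density of states of bond percolation with parameter $\mathsf p=1/|H|$ on $X(G,S)$ are related by $$\mathfrak m^{\mathrm{bd}}(B)=\mathsf E_{\mathsf p}\bigl(\mathfrak n_\omega^{\mathrm{bd}}(B)\bigr)\quad\text{for every Borel set }B\subset\mathbb R.$$
   Context: $G$ is a finitely generated group with identity $e$; $H$ is a finite group with identity $o$ and $|H|\ge2$. $\mu$ is a symmetric probability measure on $G$ whose support $S$ is finite and generates $G$; $p(x,y)=\mu(x^{-1}y)$. The Cayley graph $X(G,S)$ has vertex set $G$ and unoriented edge set $E=\{[x,xs]=[xs,x]:x\in G,s\in S\}$. $\mathcal L^{\mathrm{bd}}=\bigoplus_EH$ is the group (under pointwise multiplication) of functions $\eta:E\to H$ with finite support $\{\varepsilon\in E:\eta(\varepsilon)\neq o\}$, with identity $\iota\equiv o$. $G$ acts on $E$ by $g[x,y]=[gx,gy]$ and on $\mathcal L^{\mathrm{bd}}$ by $L_g\eta([x,y])=\eta([g^{-1}x,g^{-1}y])$; $\mathcal L^{\mathrm{bd}}\rtimes G$ has product $(\eta,g)(\eta',g')=(\eta\cdot L_g\eta',gg')$. The law of the edge enlightening random walk is the symmetric probability measure $$\widetilde\mu_{\mathrm{bd}}(\eta,g)=\begin{cases}\mu(g)/|H|,&\text{if }g\in S\text{ and }\operatorname{supp}(\eta)\subset\{[e,g]\},\\0,&\text{otherwise.}\end{cases}$$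 Its Plancherel measure $\mathfrak m^{\mathrm{bd}}$ is the diagonal element at $(\iota,e)$ of the resolution of the identity of the self-adjoint operator $F\mapsto F*\widetilde\mu_{\mathrm{bd}}$ on $\ell^2(\mathcal L^{\mathrm{bd}}\rtimes G)$, i.e. the probability measure on $[-1,1]$ whose $n$-th moment is $\widetilde\mu_{\mathrm{bd}}^{(n)}(\iota,e)$ ($n$-th convolution power) for all $n\ge 0$. Bond percolation with parameter $\mathsf p$ (expectation $\mathsf E_{\mathsf p}$): each edge in $E$ is independently open with probability $\mathsf p$ and closed otherwise; closed edges are removed, and $C_\omega^{\mathrm{bd}}(e)$ is the connected component of $e$ in the remaining graph. For a connected subgraph $A$ of $X(G,S)$ (not necessarily induced) containing $e$, with edge set $E(A)$, set $p_A(x,y)=p(x,y)$ if $[x,y]\in E(A)$ and $0$ otherwise, and let $P_A$ be the self-adjoint operator $P_Af(x)=\sum_yp_A(x,y)f(y)$ on $\ell^2(G)$. $\mathfrak n_A^{\mathrm{bd}}$ is the diagonal element at $e$ of its spectral resolution, i.e. the probability measure with $n$-th moment $p_A^{(n)}(e,e)$ (entry of $P_A^n$) for all $n\ge 0$; $\mathfrak n^{\mathrm{bd}}_\omega=\mathfrak n^{\mathrm{bd}}_{A}$ for $A=C^{\mathrm{bd}}_\omega(e)$. The integrated density of states is the measure $B\mapsto\mathsf E_{\mathsf p}(\mathfrak n^{\mathrm{bd}}_\omega(B))$. *)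

theory Defs
  imports
    "HOL-Algebra.Generated_Groups"
    "HOL-Algebra.Product_Groups"
    "HOL-Probability.Probability"
begin

(* An unoriented edge [x,y] is the set {x,y}.  If the identity belongs to S, then every
   vertex x carries the loop [x,x] = {x}, which is an edge like any other. *)
definition cayley_edges :: "('a, 'c) monoid_scheme \<Rightarrow> 'a set \<Rightarrow> 'a set set" where
  "cayley_edges G S = {{x, x \<otimes>\<^bsub>G\<^esub> s} | x s. x \<in> carrier G \<and> s \<in> S}"

definition lamp_group ::
  "('a, 'c) monoid_scheme \<Rightarrow> 'a set \<Rightarrow> ('h, 'd) monoid_scheme \<Rightarrow> ('a set \<Rightarrow> 'h) monoid" where
  "lamp_group G S H = sum_group (cayley_edges G S) (\<lambda>_. H)"

definition lamp_action ::
  "('a, 'c) monoid_scheme \<Rightarrow> 'a set \<Rightarrow> 'a \<Rightarrow> ('a set \<Rightarrow> 'h) \<Rightarrow> 'a set \<Rightarrow> 'h" where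
  "lamp_action G S g \<eta> =
     (\<lambda>\<epsilon>\<in>cayley_edges G S. \<eta> ((\<lambda>x. inv\<^bsub>G\<^esub> g \<otimes>\<^bsub>G\<^esub> x) ` \<epsilon>))"

definition lamp_semidirect ::
  "('a, 'c) monoid_scheme \<Rightarrow> 'a set \<Rightarrow> ('h, 'd) monoid_scheme
     \<Rightarrow> (('a set \<Rightarrow> 'h) \<times> 'a) monoid" where
  "lamp_semidirect G S H =
     \<lparr>carrier = carrier (lamp_group G S H) \<times> carrier G,
      monoid.mult = (\<lambda>(\<eta>, g) (\<eta>', g').
        (\<eta> \<otimes>\<^bsub>lamp_group G S H\<^esub> lamp_action G S g \<eta>', g \<otimes>\<^bsub>G\<^esub> g')),
      one = (\<one>\<^bsub>lamp_group G S H\<^esub>, \<one>\<^bsub>G\<^esub>)\<rparr>"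

definition enlightening_law ::
  "('a, 'c) monoid_scheme \<Rightarrow> ('h, 'd) monoid_scheme \<Rightarrow> 'a pmf
     \<Rightarrow> (('a set \<Rightarrow> 'h) \<times> 'a) \<Rightarrow> real" where
  "enlightening_law G H \<mu> = (\<lambda>(\<eta>, g).
     if g \<in> set_pmf \<mu> \<and>
        {\<epsilon> \<in> cayley_edges G (set_pmf \<mu>). \<eta> \<epsilon> \<noteq> \<one>\<^bsub>H\<^esub>} \<subseteq> {{\<one>\<^bsub>G\<^esub>, g}}
     then pmf \<mu> g / real (card (carrier H)) else 0)"

definition right_convolution ::
  "('k, 'c) monoid_scheme \<Rightarrow> ('k \<Rightarrow> real) \<Rightarrow> ('k \<Rightarrow> real) \<Rightarrow> 'k \<Rightarrow> real" where
  "right_convolution K \<nu> F = (\<lambda>x. \<Sum>\<^sub>\<infinity>y\<in>carrier K. F y * \<nu> (inv\<^bsub>K\<^esub> y \<otimes>\<^bsub>K\<^esub> x))"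

(* The diagonal element at x of the resolution of the identity of a self-adjoint contraction T,
   given as the probability measure on [-1,1] whose n-th moment is the diagonal matrix entry
   of T^n at x, i.e. T^n applied to the unit mass at x, evaluated at x. *)
definition diagonal_spectral_measure ::
  "(('k \<Rightarrow> real) \<Rightarrow> 'k \<Rightarrow> real) \<Rightarrow> 'k \<Rightarrow> real measure" where
  "diagonal_spectral_measure T x =
     (THE M. prob_space M \<and> sets M = sets borel \<and> (AE t in M. t \<in> {-1..1}) \<and>
             (\<forall>n. (\<integral>t. t ^ n \<partial>M) = (T ^^ n) (indicator {x}) x))"

(* For T = right_convolution K \<nu> and x the identity of K, the diagonal entry of T^n is the
   n-th convolution power of \<nu> at the identity. *)
definition plancherel_measure ::
  "('a, 'c) monoid_scheme \<Rightarrow> ('h, 'd) monoid_scheme \<Rightarrow> 'a pmf \<Rightarrow> real measure" where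
  "plancherel_measure G H \<mu> =
     (let K = lamp_semidirect G (set_pmf \<mu>) H
      in diagonal_spectral_measure (right_convolution K (enlightening_law G H \<mu>)) \<one>\<^bsub>K\<^esub>)"

(* A configuration \<omega> maps an edge to True iff the edge is open. *)
definition bond_percolation ::
  "('a, 'c) monoid_scheme \<Rightarrow> 'a set \<Rightarrow> real \<Rightarrow> ('a set \<Rightarrow> bool) measure" where
  "bond_percolation G S p = (\<Pi>\<^sub>M \<epsilon>\<in>cayley_edges G S. measure_pmf (bernoulli_pmf p))"

definition cluster_vertices ::
  "('a, 'c) monoid_scheme \<Rightarrow> 'a set \<Rightarrow> ('a set \<Rightarrow> bool) \<Rightarrow> 'a set" where
  "cluster_vertices G S \<omega> =
     {x. (\<one>\<^bsub>G\<^esub>, x) \<in> {(y, z). {y, z} \<in> cayley_edges G S \<and> \<omega> {y, z}}\<^sup>*}"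

definition cluster_edges ::
  "('a, 'c) monoid_scheme \<Rightarrow> 'a set \<Rightarrow> ('a set \<Rightarrow> bool) \<Rightarrow> 'a set set" where
  "cluster_edges G S \<omega> =
     {\<epsilon> \<in> cayley_edges G S. \<omega> \<epsilon> \<and> \<epsilon> \<subseteq> cluster_vertices G S \<omega>}"

(* A subgraph A enters the operator only through its edge set EA. *)
definition subgraph_operator ::
  "('a, 'c) monoid_scheme \<Rightarrow> 'a pmf \<Rightarrow> 'a set set \<Rightarrow> ('a \<Rightarrow> real) \<Rightarrow> 'a \<Rightarrow> real" where
  "subgraph_operator G \<mu> EA f =
     (\<lambda>x. \<Sum>\<^sub>\<infinity>y\<in>carrier G. (if {x, y} \<in> EA then pmf \<mu> (inv\<^bsub>G\<^esub> x \<otimes>\<^bsub>G\<^esub> y) else 0) * f y)"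

definition cluster_spectral_measure ::
  "('a, 'c) monoid_scheme \<Rightarrow> 'a pmf \<Rightarrow> ('a set \<Rightarrow> bool) \<Rightarrow> real measure" where
  "cluster_spectral_measure G \<mu> \<omega> =
     diagonal_spectral_measure
       (subgraph_operator G \<mu> (cluster_edges G (set_pmf \<mu>) \<omega>)) \<one>\<^bsub>G\<^esub>"

end

theory Submission
  imports Defs
begin

text \<open>At each step the enlightening walk averages the lamp of the traversed edge over \<open>H\<close>.  These averaging
  operators are commuting projections, and jointly their spectral measure at the unit mass at \<open>\<iota>\<close> is
  that of independent Bernoulli variables with parameter \<open>1 / |H|\<close>: an edge is open where the projection
  has the value 1 and closed where it has the value 0.  In joint spectral coordinates the walk thus
  becomes the random walk killed at closed edges.  Concretely, the \<open>n\<close>-step weight at \<open>(\<zeta>, x)\<close> is the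
  expectation of the killed \<open>n\<close>-step weight at \<open>x\<close> times a product over the support of \<open>\<zeta>\<close> of factors
  \<open>1\<close> (open) or \<open>- 1 / (|H| - 1)\<close> (closed), which follows by induction on \<open>n\<close>; at \<open>\<zeta> = \<iota>\<close> the product is
  \<open>1\<close>.  Both measures thus have the same moments, and measures on \<open>[-1, 1]\<close> are determined by
  their moments.  The spectral measures exist by the Hausdorff moment problem: \<open>f \<mapsto> \<langle>f(T) \<delta>, \<delta>\<rangle>\<close> is
  nonnegative on squares and on squares times \<open>1 - t\<^sup>2\<close>, hence on Bernstein polynomials, and a weak
  limit of Bernstein approximations has the required moments.\<close>

section \<open>Probability measures on [-1, 1] and their moments\<close>

text \<open>The condition under the definite description in
  \<open>diagonal_spectral_measure\<close>, with the moment sequence as a parameter.\<close>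

definition has_moments :: "real measure \<Rightarrow> (nat \<Rightarrow> real) \<Rightarrow> bool" where
  "has_moments M m \<longleftrightarrow> prob_space M \<and> sets M = sets borel \<and> (AE t in M. t \<in> {-1..1}) \<and>
     (\<forall>n. (\<integral>t. t ^ n \<partial>M) = m n)"

lemma has_moments_integrable:
  fixes f :: "real \<Rightarrow> real"
  assumes M: "has_moments M m" and f: "f \<in> borel_measurable borel"
    and B: "\<And>t. t \<in> {-1..1} \<Longrightarrow> \<bar>f t\<bar> \<le> B"
  shows "integrable M f"
proof -
  interpret prob_space M using M by (simp add: has_moments_def)
  have AE: "AE t in M. t \<in> {-1..1}" and sets: "sets M = sets borel"
    using M by (auto simp: has_moments_def)
  show ?thesis
  proof (rule integrable_const_bound)
    show "AE t in M. norm (f t) \<le> B" using AE by eventually_elim (use B in auto)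
    show "f \<in> borel_measurable M" using f measurable_cong_sets[OF sets refl] by blast
  qed
qed

lemma has_moments_integral_polynomial:
  assumes M: "has_moments M m"
  shows "(\<integral>t. (\<Sum>i\<le>n. a i * t ^ i) \<partial>M) = (\<Sum>i\<le>n. a i * m i)"
proof -
  have int: "integrable M (\<lambda>t. t ^ i)" for i
    by (rule has_moments_integrable[OF M, where B=1]) (auto simp: power_abs power_le_one)
  show ?thesis using M int by (simp add: has_moments_def)
qed

lemma has_moments_integral_cong:
  assumes "has_moments M m" and f: "f \<in> borel_measurable borel" and g: "g \<in> borel_measurable borel"
    and "\<And>t. t \<in> {-1..1} \<Longrightarrow> f t = (g t :: real)"
  shows "(\<integral>t. f t \<partial>M) = (\<integral>t. g t \<partial>M)"
proof (rule integral_cong_AE)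
  have AE: "AE t in M. t \<in> {-1..1}" and sets: "sets M = sets borel"
    using assms(1) by (auto simp: has_moments_def)
  show "AE t in M. f t = g t" using AE by eventually_elim (use assms(4) in auto)
  show "f \<in> borel_measurable M" "g \<in> borel_measurable M"
    using f g measurable_cong_sets[OF sets refl] by blast+
qed

section \<open>Distribution functions from moments\<close>

definition ramp :: "real \<Rightarrow> nat \<Rightarrow> real \<Rightarrow> real" where
  "ramp a j t = max 0 (min 1 (1 - real j * (t - a)))"

lemma ramp_bounds: "0 \<le> ramp a j t" "ramp a j t \<le> 1" by (auto simp: ramp_def)

lemma continuous_on_ramp: "continuous_on S (ramp a j)"
  unfolding ramp_def by (intro continuous_intros)

lemma ramp_borel [measurable]: "ramp a j \<in> borel_measurable borel"
  by (rule borel_measurable_continuous_onI) (rule continuous_on_ramp)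

text \<open>For t > a the ramp is 0 as soon as j (t - a) > 1, and for t \<le> a it is always
  1.\<close>

lemma ramp_tendsto: "(\<lambda>j. ramp a j t) \<longlonglongrightarrow> indicator {..a} t"
proof (cases "t \<le> a")
  case True
  then have "ramp a j t = 1" for j 
    using mult_nonneg_nonpos[of "real j" "t - a"] by (auto simp: ramp_def)
  then show ?thesis using True by simp
next
  case False
  then obtain N where N: "real N * (t - a) > 1"
    by (metis diff_gt_0_iff_gt ex_less_of_nat_mult linorder_not_le)
  have "ramp a j t = 0" if "j \<ge> N" for j
  proof -
    have "real j * (t - a) \<ge> real N * (t - a)" using that False by (intro mult_right_mono) auto
    then show ?thesis using N by (auto simp: ramp_def)
  qed
  then have "\<forall>\<^sub>F j in sequentially. ramp a j t = 0" by (auto simp: eventually_sequentially)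
  then show ?thesis using False by (simp add: tendsto_eventually)
qed

text \<open>Weierstrass approximation on a compact interval. A polynomial is coded by its
  coefficients and a degree bound, so that replacing \<open>t ^ i\<close> by \<open>m i\<close>
  turns it into a linear expression in the moments.\<close>

lemma ramp_approximation:
  "\<exists>b :: (nat \<Rightarrow> real) \<times> nat. \<forall>t\<in>{-1..1}. \<bar>ramp a j t - (\<Sum>i\<le>snd b. fst b i * t ^ i)\<bar> < 1 / real (Suc n)"
proof -
  obtain g where g: "real_polynomial_function g"
    "\<And>t. t \<in> {-1..1::real} \<Longrightarrow> \<bar>ramp a j t - g t\<bar> < 1 / real (Suc n)"
    using Stone_Weierstrass_real_polynomial_function[of "{-1..1::real}" "ramp a j" "1 / real (Suc n)"]
      continuous_on_ramp by (metis compact_Icc divide_pos_pos of_nat_0_less_iff zero_less_Suc zero_less_one)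
  then obtain c N where "g = (\<lambda>x. \<Sum>i\<le>N. c i * x^i)" by (auto simp: real_polynomial_function_iff_sum)
  then show ?thesis using g(2) by (intro exI[of _ "(c, N)"]) auto
qed

text \<open>The choice depends on neither a measure nor a moment sequence, so one family of
  polynomials serves all of them.\<close>

definition ramp_poly :: "real \<Rightarrow> nat \<Rightarrow> nat \<Rightarrow> (nat \<Rightarrow> real) \<times> nat" where
  "ramp_poly a j n = (SOME b. \<forall>t\<in>{-1..1}. \<bar>ramp a j t - (\<Sum>i\<le>snd b. fst b i * t ^ i)\<bar> < 1 / real (Suc n))"

text \<open>Recovers the distribution function from the moments alone; its explicit form makes uniqueness and
  measurability in a parameter immediate.\<close>
definition moment_cdf :: "(nat \<Rightarrow> real) \<Rightarrow> real \<Rightarrow> real" where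
  "moment_cdf m a =
     lim (\<lambda>j. lim (\<lambda>n. \<Sum>i\<le>snd (ramp_poly a j n). fst (ramp_poly a j n) i * m i))"

text \<open>The polynomials approximate the ramp on [-1, 1], which carries \<open>M\<close>, so the
  inner limit is the integral of the ramp; the ramps tend to the indicator of \<open>{..a}\<close>,
  which gives the outer limit. Both are instances of dominated convergence.\<close>

lemma cdf_eq_moment_cdf:
  assumes M: "has_moments M m"
  shows "measure M {..a} = moment_cdf m a"
proof -
  interpret prob_space M using M by (simp add: has_moments_def)
  have AE: "AE t in M. t \<in> {-1..1}" and sets: "sets M = sets borel"
    using M by (auto simp: has_moments_def)
  have meas: "f \<in> borel_measurable M" if "f \<in> borel_measurable borel" for f :: "real \<Rightarrow> real"
    using that measurable_cong_sets[OF sets refl] by blast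
  let ?q = "\<lambda>j n t. \<Sum>i\<le>snd (ramp_poly a j n). fst (ramp_poly a j n) i * t ^ i"
  have q: "\<bar>ramp a j t - ?q j n t\<bar> < 1 / real (Suc n)" if "t \<in> {-1..1}" for j n t
    using someI_ex[OF ramp_approximation[of a j n]] that unfolding ramp_poly_def by blast
  have inner: "(\<lambda>n. \<Sum>i\<le>snd (ramp_poly a j n). fst (ramp_poly a j n) i * m i) \<longlonglongrightarrow> (\<integral>t. ramp a j t \<partial>M)" for j
    unfolding has_moments_integral_polynomial[OF M, symmetric]
  proof (rule integral_dominated_convergence[where w="\<lambda>_. 2"])
    show "ramp a j \<in> borel_measurable M" by (rule meas) measurable
    show "?q j n \<in> borel_measurable M" for n by (rule meas) measurable
    show "integrable M (\<lambda>_. 2)" by simp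
    show "AE t in M. (\<lambda>n. ?q j n t) \<longlonglongrightarrow> ramp a j t"
      using AE
    proof eventually_elim
      fix t :: real assume t: "t \<in> {-1..1}"
      show "(\<lambda>n. ?q j n t) \<longlonglongrightarrow> ramp a j t"
      proof (rule LIMSEQ_I)
        fix r :: real assume "r > 0"
        then obtain N where "inverse (real (Suc N)) < r" using reals_Archimedean by blast
        moreover have "1 / real (Suc n) \<le> 1 / real (Suc N)" if "n \<ge> N" for n
          using that by (intro divide_left_mono) auto
        ultimately have "norm (?q j n t - ramp a j t) < r" if "n \<ge> N" for n
          using q[OF t, of j n] that by (force simp: inverse_eq_divide abs_minus_commute)
        then show "\<exists>N. \<forall>n\<ge>N. norm (?q j n t - ramp a j t) < r" by blast
      qed
    qed
    show "AE t in M. norm (?q j n t) \<le> 2" for n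
      using AE
    proof eventually_elim
      fix t :: real assume t: "t \<in> {-1..1}"
      \<comment> \<open>The dominating constant 2 is the bound 1 of the ramp plus an approximation
        error of at most 1.\<close>
      have "1 / real (Suc n) \<le> 1" by simp
      then show "norm (?q j n t) \<le> 2" using q[OF t, of j n] ramp_bounds[of a j t] unfolding real_norm_def by linarith
    qed
  qed
  have "(\<lambda>j. \<integral>t. ramp a j t \<partial>M) \<longlonglongrightarrow> (\<integral>t. indicator {..a} t \<partial>M)"
  proof (rule integral_dominated_convergence[where w="\<lambda>_. 1"])
    show "(indicator {..a} :: real \<Rightarrow> real) \<in> borel_measurable M" by (rule meas) measurable
    show "ramp a j \<in> borel_measurable M" for j by (rule meas) measurable
    show "AE t in M. (\<lambda>j. ramp a j t) \<longlonglongrightarrow> indicator {..a} t" using ramp_tendsto by blast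
  qed (auto simp: ramp_bounds)
  then have "lim (\<lambda>j. \<integral>t. ramp a j t \<partial>M) = measure M {..a}"
    by (simp add: limI sets sets_eq_imp_space_eq[OF sets])
  then show ?thesis using limI[OF inner] by (simp add: moment_cdf_def)
qed

lemma has_moments_unique:
  assumes "has_moments M m" "has_moments M' m"
  shows "M = M'"
proof (rule cdf_unique)
  show "real_distribution M" "real_distribution M'"
    using assms by (auto simp: has_moments_def real_distribution_def real_distribution_axioms_def
        dest: sets_eq_imp_space_eq)
  show "cdf M = cdf M'"
    using cdf_eq_moment_cdf[OF assms(1)] cdf_eq_moment_cdf[OF assms(2)] by (auto simp: cdf_def)
qed

text \<open>By uniqueness, any measure with the right moments evaluates the definite
  description.\<close>

lemma diagonal_spectral_measure_eqI:
  assumes "has_moments M (\<lambda>n. (T ^^ n) (indicator {x}) x)"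
  shows "diagonal_spectral_measure T x = M"
  unfolding diagonal_spectral_measure_def has_moments_def[symmetric, of _ "\<lambda>n. (T ^^ n) (indicator {x}) x"]
  using assms has_moments_unique by (intro the_equality) blast+

section \<open>Mixtures of measures with given moments\<close>

lemma measurable_has_moments_kernel:
  assumes K: "\<And>\<omega>. \<omega> \<in> space P \<Longrightarrow> has_moments (K \<omega>) (m \<omega>)"
    and m [measurable]: "\<And>n. (\<lambda>\<omega>. m \<omega> n) \<in> borel_measurable P"
  shows "K \<in> measurable P (subprob_algebra borel)"
proof (rule measurable_subprob_algebra_generated)
  show "sets borel = sigma_sets UNIV (range (\<lambda>a::real. {..a}))"
    by (subst borel_eq_atMost) (simp add: sets_measure_of)
  show "Int_stable (range (\<lambda>a::real. {..a}))" by (auto simp: Int_stable_def)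
  show "range (\<lambda>a::real. {..a}) \<subseteq> Pow UNIV" by simp
  have prob: "prob_space (K \<omega>)" and sets: "sets (K \<omega>) = sets borel" if "\<omega> \<in> space P" for \<omega>
    using K[OF that] by (auto simp: has_moments_def)
  show "subprob_space (K \<omega>)" if "\<omega> \<in> space P" for \<omega>
    using prob[OF that] by (rule prob_space_imp_subprob_space)
  show "sets (K \<omega>) = sets borel" if "\<omega> \<in> space P" for \<omega> by (rule sets[OF that])
  show "(\<lambda>\<omega>. emeasure (K \<omega>) A) \<in> borel_measurable P" if A_range: "A \<in> range (\<lambda>a::real. {..a})" for A
  proof -
    obtain a where A: "A = {..a}" using A_range by auto
    \<comment> \<open>Half-lines generate the Borel sets, and on them the kernel is an iterated
      limit of finite linear combinations of measurable moments, with coefficients independent of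
      \<omega>.\<close>
    have "(\<lambda>\<omega>. ennreal (moment_cdf (m \<omega>) a)) \<in> borel_measurable P"
      unfolding moment_cdf_def by measurable
    moreover have "emeasure (K \<omega>) A = ennreal (moment_cdf (m \<omega>) a)" if "\<omega> \<in> space P" for \<omega>
    proof -
      interpret prob_space "K \<omega>" by (rule prob[OF that])
      show ?thesis by (simp add: emeasure_eq_measure A cdf_eq_moment_cdf[OF K[OF that]])
    qed
    ultimately show ?thesis by (simp cong: measurable_cong)
  qed
  show "(\<lambda>\<omega>. emeasure (K \<omega>) UNIV) \<in> borel_measurable P"
  proof -
    have "emeasure (K \<omega>) UNIV = 1" if "\<omega> \<in> space P" for \<omega>
      using prob_space.emeasure_space_1[OF prob[OF that]] sets_eq_imp_space_eq[OF sets[OF that]] by simp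
    then show ?thesis by (simp cong: measurable_cong)
  qed
qed

lemma has_moments_bind:
  assumes P: "prob_space P" and K: "\<And>\<omega>. \<omega> \<in> space P \<Longrightarrow> has_moments (K \<omega>) (m \<omega>)"
    and m [measurable]: "\<And>n. (\<lambda>\<omega>. m \<omega> n) \<in> borel_measurable P"
  shows "has_moments (P \<bind> K) (\<lambda>n. \<integral>\<omega>. m \<omega> n \<partial>P)"
proof -
  interpret P: prob_space P by (rule P)
  note K_meas [measurable] = measurable_has_moments_kernel[OF K m]
  have ne: "space P \<noteq> {}" by (rule P.not_empty)
  have prob: "prob_space (K \<omega>)" and sets: "sets (K \<omega>) = sets borel"
    and AE: "AE t in K \<omega>. t \<in> {-1..1}" if "\<omega> \<in> space P" for \<omega>
    using K[OF that] by (auto simp: has_moments_def)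
  have sets_bind: "sets (P \<bind> K) = sets borel" by (rule sets_bind) (use sets ne in auto)
  have prob_bind: "prob_space (P \<bind> K)"
    by (rule P.prob_space_bind[OF _ K_meas]) (use prob in auto)
  have AE_bind: "AE t in P \<bind> K. t \<in> {-1..1}"
    by (subst AE_bind[OF K_meas]) (use AE in auto)
  have "(\<integral>t. t ^ n \<partial>(P \<bind> K)) = (\<integral>\<omega>. m \<omega> n \<partial>P)" for n
  proof -
    \<comment> \<open>\<open>integral_bind\<close> asks for an integrand that is bounded everywhere.
      The cut-off changes nothing almost everywhere, since all the measures live on [-1, 1].\<close>
    let ?f = "\<lambda>t::real. indicator {-1..1} t * t ^ n"
    interpret B: prob_space "P \<bind> K" by (rule prob_bind)
    have f: "?f \<in> borel_measurable borel" by measurable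
    have "has_moments (P \<bind> K) (\<lambda>n. \<integral>t. t ^ n \<partial>(P \<bind> K))"
      using prob_bind sets_bind AE_bind by (simp add: has_moments_def)
    then have "(\<integral>t. t ^ n \<partial>(P \<bind> K)) = (\<integral>t. ?f t \<partial>(P \<bind> K))"
      by (rule has_moments_integral_cong) (auto simp: indicator_def)
    also have "\<dots> = (\<integral>\<omega>. \<integral>t. ?f t \<partial>K \<omega> \<partial>P)"
    proof (rule integral_bind[where K=borel and B=1 and B'=1])
      show "\<bar>?f t\<bar> \<le> 1" for t by (auto simp: indicator_def power_abs power_le_one)
    qed (auto simp: subprob_space.emeasure_space_le_1 prob prob_space_imp_subprob_space ne P.emeasure_space_1 
         intro!: prob_space.emeasure_space_1[THEN eq_refl])
    also have "\<dots> = (\<integral>\<omega>. m \<omega> n \<partial>P)"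
    proof (rule Bochner_Integration.integral_cong[OF refl])
      fix \<omega> assume w: "\<omega> \<in> space P"
      have "(\<integral>t. ?f t \<partial>K \<omega>) = (\<integral>t. t ^ n \<partial>K \<omega>)"
        by (rule has_moments_integral_cong[OF K[OF w]]) (auto simp: indicator_def)
      then show "(\<integral>t. ?f t \<partial>K \<omega>) = m \<omega> n" using K[OF w] by (simp add: has_moments_def)
    qed
    finally show ?thesis .
  qed
  then show ?thesis using prob_bind sets_bind AE_bind by (simp add: has_moments_def)
qed

section \<open>Existence for positive functionals\<close>

text \<open>Serves to pass from factorial moments to power moments. Both terms are products of j
  factors of modulus at most 1, so they differ by at most the sum of the differences of the factors,
  each at most j / (n - j).\<close>

lemma choose_ratio_approximation:
  fixes n k j :: nat
  assumes n: "n > 2 * j" and k: "k \<le> n"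
  shows "\<bar>(real k / real n) ^ j - real (k choose j) / real (n choose j)\<bar> \<le> real (j * j) / real (n - j)"
proof -
  have prods: "real (m choose j) = (\<Prod>i<j. real m - real i) / fact j" for m
    by (simp add: binomial_gbinomial gbinomial_prod_rev atLeast0LessThan)
  have "real (k choose j) / real (n choose j) = (\<Prod>i<j. real k - real i) / (\<Prod>i<j. real n - real i)"
    unfolding prods by simp
  then have ratio: "real (k choose j) / real (n choose j) = (\<Prod>i<j. (real k - real i) / (real n - real i))"
    by (simp add: prod_dividef)
  have "norm ((\<Prod>i<j. real k / real n) - (\<Prod>i<j. (real k - real i) / (real n - real i)))
     \<le> (\<Sum>i<j. norm (real k / real n - (real k - real i) / (real n - real i)))"
  proof (rule norm_prod_diff)
    show "norm (real k / real n) \<le> 1" for i using k by (cases "n = 0") auto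
    fix i assume "i \<in> {..<j}"
    \<comment> \<open>The numerator is negative when k < i; even then n > 2 j keeps its modulus
      below the denominator.\<close>
    then have "\<bar>real k - real i\<bar> \<le> real n - real i" "real n - real i > 0" using n k by auto
    then show "norm ((real k - real i) / (real n - real i)) \<le> 1" by (simp add: abs_mult divide_le_eq)
  qed
  also have "\<dots> \<le> (\<Sum>i<j. real j / real (n - j))"
  proof (rule sum_mono)
    fix i assume i: "i \<in> {..<j}"
    have pos: "real n > 0" "real n - real i > 0" "real (n - j) > 0" using n i by auto
    have "real k / real n - (real k - real i) / (real n - real i)
        = (real i / (real n - real i)) * ((real n - real k) / real n)"
      using pos by (simp add: field_simps)
    moreover have "\<bar>(real n - real k) / real n\<bar> \<le> 1" using k pos by (simp add: field_simps)
    ultimately have "norm (real k / real n - (real k - real i) / (real n - real i)) \<le> \<bar>real i / (real n - real i)\<bar>"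
      by (metis abs_mult real_norm_def abs_ge_zero mult_left_le)
    also have "\<dots> = real i / (real n - real i)" using pos by simp
    also have "\<dots> \<le> real j / real (n - j)"
      using i pos n by (intro frac_le) auto
    finally show "norm (real k / real n - (real k - real i) / (real n - real i)) \<le> real j / real (n - j)" .
  qed
  finally show ?thesis using ratio by simp
qed

text \<open>Composition with \<open>clamp1\<close> makes a polynomial a bounded continuous function
  on the whole line, as weak convergence requires, without changing it on [-1, 1].\<close>

definition clamp1 :: "real \<Rightarrow> real" where "clamp1 t = max (-1) (min 1 t)"

lemma clamp1_eq: "t \<in> {-1..1} \<Longrightarrow> clamp1 t = t" by (auto simp: clamp1_def)

lemma clamp1_range: "clamp1 t \<in> {-1..1}" by (auto simp: clamp1_def)

lemma isCont_clamp1: "isCont clamp1 x"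
  unfolding clamp1_def by (intro continuous_intros)

lemma clamp1_borel [measurable]: "clamp1 \<in> borel_measurable borel"
  unfolding clamp1_def by measurable

section \<open>Positivity on Bernstein polynomials and the resulting masses\<close>

locale positive_functional =
  fixes L :: "real poly \<Rightarrow> real"
  assumes L_add: "L (p + q) = L p + L q"
    and L_smult: "L (Polynomial.smult c p) = c * L p"
    and L_one: "L 1 = 1"
    and L_square: "0 \<le> L (p * p)"
    and L_weighted_square: "0 \<le> L ([:1, 0, -1:] * (p * p))"
begin

lemma L_zero: "L 0 = 0" using L_smult[of 0 0] by simp

lemma L_sum: "L (\<Sum>i\<in>I. p i) = (\<Sum>i\<in>I. L (p i))"
  by (induction I rule: infinite_finite_induct) (auto simp: L_zero L_add)

text \<open>\<open>Y\<close> and \<open>Z\<close> are (1 + t) / 2 and (1 - t) / 2, which carry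
  [-1, 1] to [0, 1]. Besides Y + Z = 1 they satisfy 4 Y Z = 1 - t^2, the weight in
  \<open>L_weighted_square\<close>.\<close>

definition Y :: "real poly" where "Y = [:1/2, 1/2:]"
definition Z :: "real poly" where "Z = [:1/2, -1/2:]"

lemma Y_plus_Z: "Y + Z = 1" by (simp add: Y_def Z_def one_pCons)

lemma four_YZ: "[:1, 0, -1:] = Polynomial.smult 4 (Y * Z)" by (simp add: Y_def Z_def)

lemma L_even: "0 \<le> L (Y ^ (2 * a) * Z ^ (2 * b))"
proof -
  have "Y ^ (2 * a) * Z ^ (2 * b) = (Y ^ a * Z ^ b) * (Y ^ a * Z ^ b)"
    unfolding mult_2 power_add by (simp add: mult_ac)
  then show ?thesis using L_square by simp
qed

lemma L_odd: "0 \<le> L (Y ^ Suc (2 * a) * Z ^ Suc (2 * b))"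
proof -
  have "[:1, 0, -1:] * ((Y ^ a * Z ^ b) * (Y ^ a * Z ^ b)) = Polynomial.smult 4 (Y ^ Suc (2 * a) * Z ^ Suc (2 * b))"
    unfolding four_YZ mult_2 power_Suc power_add by (simp add: mult_ac)
  then show ?thesis using L_weighted_square[of "Y ^ a * Z ^ b"] by (simp add: L_smult)
qed

text \<open>If both exponents are even the product is a square, and if both are odd it is Y Z times
  a square. For mixed parity, multiplication by Y + Z = 1 splits it into one product of each of
  these kinds.\<close>

lemma L_Bernstein_nonneg: "0 \<le> L (Y ^ k * Z ^ l)"
proof -
  have *: "Y ^ k * Z ^ l = Y ^ Suc k * Z ^ l + Y ^ k * Z ^ Suc l"
  proof -
    have "Y ^ k * Z ^ l = Y ^ k * Z ^ l * (Y + Z)" by (simp add: Y_plus_Z)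
    then show ?thesis by (simp add: algebra_simps)
  qed
  have half: "n = 2 * (n div 2) \<or> n = Suc (2 * (n div 2))" for n :: nat by presburger
  consider a b where "k = 2 * a" "l = 2 * b" | a b where "k = Suc (2 * a)" "l = Suc (2 * b)"
    | a b where "k = Suc (2 * a)" "l = 2 * b" | a b where "k = 2 * a" "l = Suc (2 * b)"
    using half[of k] half[of l] by blast
  then show ?thesis
  proof cases
    case 1 then show ?thesis using L_even by simp
  next
    case 2 then show ?thesis using L_odd by simp
  next
    case 3
    then show ?thesis using L_even[of "Suc a" b] L_odd[of a b] * by (simp add: L_add)
  next
    case 4
    then show ?thesis using L_even[of a "Suc b"] L_odd[of a b] * by (simp add: L_add)
  qed
qed

text \<open>The mass that the \<open>n\<close>-th Bernstein approximation of the measure sought puts on the node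
  \<open>2 * k / n - 1\<close>.\<close>
definition bern_mass :: "nat \<Rightarrow> nat \<Rightarrow> real" where
  "bern_mass n k = real (n choose k) * L (Y ^ k * Z ^ (n - k))"

lemma bern_mass_nonneg: "0 \<le> bern_mass n k"
  by (simp add: bern_mass_def L_Bernstein_nonneg)

lemma bern_mass_eq_0: "k > n \<Longrightarrow> bern_mass n k = 0"
  by (simp add: bern_mass_def)

text \<open>Apply \<open>L\<close> to the binomial expansion of Y^j (Y + Z)^(n - j); the
  coefficients match because (n choose k) (k choose j) = (n choose j) (n - j choose k - j).\<close>

lemma bern_mass_factorial_moment:
  assumes "j \<le> n"
  shows "(\<Sum>k\<le>n. real (k choose j) * bern_mass n k) = real (n choose j) * L (Y ^ j)"
proof -
  have "Y ^ j = Y ^ j * (Y + Z) ^ (n - j)" by (simp add: Y_plus_Z)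
  also have "\<dots> = (\<Sum>i\<le>n - j. Polynomial.smult (real ((n - j) choose i)) (Y ^ (i + j) * Z ^ (n - j - i)))"
    by (subst binomial_ring) (simp add: sum_distrib_left power_add mult_ac of_nat_poly)
  finally have "L (Y ^ j) = (\<Sum>i\<le>n - j. real ((n - j) choose i) * L (Y ^ (i + j) * Z ^ (n - j - i)))"
    by (metis (mono_tags, lifting) L_sum L_smult sum.cong)
  then have "real (n choose j) * L (Y ^ j)
      = (\<Sum>i\<le>n - j. real (n choose j) * real ((n - j) choose i) * L (Y ^ (i + j) * Z ^ (n - j - i)))"
    by (simp add: sum_distrib_left mult.assoc)
  also have "\<dots> = (\<Sum>k=j..n. real (k choose j) * bern_mass n k)"
  proof (rule sum.reindex_bij_witness[of _ "\<lambda>k. k - j" "\<lambda>i. i + j"])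
    fix i assume "i \<in> {..n - j}"
    then have i: "i + j \<le> n" using assms by auto
    have "(n choose (i + j)) * ((i + j) choose j) = (n choose j) * ((n - j) choose i)"
      using choose_mult[of j "i + j" n] i by simp
    then have "real (n choose (i + j)) * real ((i + j) choose j) = real (n choose j) * real ((n - j) choose i)"
      by (metis of_nat_mult)
    then show "real ((i + j) choose j) * bern_mass n (i + j)
        = real (n choose j) * real ((n - j) choose i) * L (Y ^ (i + j) * Z ^ (n - j - i))"
      using i by (simp add: bern_mass_def algebra_simps)
  qed (use assms in auto)
  also have "\<dots> = (\<Sum>k\<le>n. real (k choose j) * bern_mass n k)"
    by (rule sum.mono_neutral_left) auto
  finally show ?thesis by simp
qed

lemma bern_mass_sum: "(\<Sum>k\<le>n. bern_mass n k) = 1"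
  using bern_mass_factorial_moment[of 0 n] by (simp add: L_one)

text \<open>The factorial moments are exact for every n \<ge> j, and replacing them by powers costs
  at most j^2 / (n - j), because the masses are nonnegative with sum 1.\<close>

lemma bern_moment_tendsto:
  "(\<lambda>n. \<Sum>k\<le>n. bern_mass n k * (real k / real n) ^ j) \<longlonglongrightarrow> L (Y ^ j)"
proof (rule LIM_zero_cancel, rule tendsto_rabs_zero_cancel, rule tendsto_sandwich[OF _ _ tendsto_const])
  show "\<forall>\<^sub>F n in sequentially. 0 \<le> \<bar>(\<Sum>k\<le>n. bern_mass n k * (real k / real n) ^ j) - L (Y ^ j)\<bar>" by simp
  show "\<forall>\<^sub>F n in sequentially. \<bar>(\<Sum>k\<le>n. bern_mass n k * (real k / real n) ^ j) - L (Y ^ j)\<bar>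
      \<le> real (j * j) / real (n - j)"
    using eventually_gt_at_top[of "2 * j"]
  proof eventually_elim
    fix n assume n: "2 * j < n"
    then have "n choose j > 0" by simp
    then have "L (Y ^ j) = (\<Sum>k\<le>n. bern_mass n k * (real (k choose j) / real (n choose j)))"
      using bern_mass_factorial_moment[of j n] n
      by (simp add: field_simps sum_divide_distrib[symmetric])
    then have "\<bar>(\<Sum>k\<le>n. bern_mass n k * (real k / real n) ^ j) - L (Y ^ j)\<bar>
       = \<bar>\<Sum>k\<le>n. bern_mass n k * ((real k / real n) ^ j - real (k choose j) / real (n choose j))\<bar>"
      by (simp add: sum_subtractf right_diff_distrib)
    also have "\<dots> \<le> (\<Sum>k\<le>n. bern_mass n k * (real (j * j) / real (n - j)))"
    proof (rule order_trans[OF sum_abs sum_mono])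
      fix k assume "k \<in> {..n}"
      then show "\<bar>bern_mass n k * ((real k / real n) ^ j - real (k choose j) / real (n choose j))\<bar>
         \<le> bern_mass n k * (real (j * j) / real (n - j))"
        unfolding abs_mult abs_of_nonneg[OF bern_mass_nonneg]
        using choose_ratio_approximation[OF n] bern_mass_nonneg by (intro mult_left_mono) auto
    qed
    also have "\<dots> = real (j * j) / real (n - j)"
      by (simp add: sum_distrib_right[symmetric] sum_divide_distrib[symmetric] bern_mass_sum)
    finally show "\<bar>(\<Sum>k\<le>n. bern_mass n k * (real k / real n) ^ j) - L (Y ^ j)\<bar> \<le> real (j * j) / real (n - j)" .
  qed
  show "(\<lambda>n. real (j * j) / real (n - j)) \<longlonglongrightarrow> 0"
    by (rule LIMSEQ_offset[of _ j]) (simp add: lim_const_over_n)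
qed

section \<open>Bernstein measures and their weak limit\<close>

definition bern_pmf :: "nat \<Rightarrow> nat pmf" where
  "bern_pmf n = embed_pmf (bern_mass n)"

lemma pmf_bern_pmf: "pmf (bern_pmf n) k = bern_mass n k"
  unfolding bern_pmf_def
proof (rule pmf_embed_pmf)
  have "(\<integral>\<^sup>+ x. ennreal (bern_mass n x) \<partial>count_space UNIV) = (\<Sum>k\<le>n. ennreal (bern_mass n k))"
    by (rule nn_integral_count_space'[of "{..n}"]) (use bern_mass_eq_0[of n] in \<open>auto simp: not_le\<close>)
  then show "(\<integral>\<^sup>+ x. ennreal (bern_mass n x) \<partial>count_space UNIV) = 1"
    by (simp add: sum_ennreal bern_mass_nonneg bern_mass_sum)
qed (rule bern_mass_nonneg)

lemma set_bern_pmf: "set_pmf (bern_pmf n) \<subseteq> {..n}"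
  using bern_mass_eq_0[of n] by (auto simp: set_pmf_iff pmf_bern_pmf not_le intro!: leI)

text \<open>The nodes k / n are moved back from [0, 1] to [-1, 1]. For n = 0 the quotient is 0 by
  convention and the whole mass sits at -1.\<close>

definition bern_measure :: "nat \<Rightarrow> real measure" where
  "bern_measure n = distr (measure_pmf (bern_pmf n)) borel (\<lambda>k. 2 * (real k / real n) - 1)"

lemma real_distribution_bern_measure: "real_distribution (bern_measure n)"
  unfolding bern_measure_def real_distribution_def real_distribution_axioms_def
  by (auto intro!: measure_pmf.prob_space_distr)

lemma bern_measure_integral:
  assumes "f \<in> borel_measurable borel"
  shows "(\<integral>t. f t \<partial>bern_measure n) = (\<Sum>k\<le>n. bern_mass n k * (f (2 * (real k / real n) - 1) :: real))"
  unfolding bern_measure_def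
  by (subst integral_distr)
    (use assms in \<open>auto simp: integral_measure_pmf_real[OF finite_atMost] pmf_bern_pmf mult.commute
       intro!: integral_measure_pmf_real[OF finite_atMost, THEN trans] sum.cong dest: subsetD[OF set_bern_pmf]\<close>)

lemma bern_node_range: "k \<le> n \<Longrightarrow> 2 * (real k / real n) - 1 \<in> {-1..1}"
  by (cases "n = 0") (auto simp: divide_le_eq)

lemma tight_bern_measure: "tight bern_measure"
  unfolding tight_def
proof (intro conjI allI impI)
  show "real_distribution (bern_measure n)" for n by (rule real_distribution_bern_measure)
  fix \<epsilon> :: real assume "\<epsilon> > 0"
  \<comment> \<open>Tightness is phrased with half-open intervals, so the left end must lie strictly
    below the node -1. One interval then serves every \<epsilon>.\<close>
  have ind: "indicator {-2<..1} t = (1 :: real)" if "t \<in> {-1..1}" for t :: real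
    using that by simp
  have "measure (bern_measure n) {-2<..1} = 1" for n
  proof -
    have "measure (bern_measure n) {-2<..1} = (\<integral>t. indicator {-2<..1} t \<partial>bern_measure n)"
      by (simp add: bern_measure_def)
    also have "\<dots> = (\<Sum>k\<le>n. bern_mass n k * indicator {-2<..1} (2 * (real k / real n) - 1))"
      by (rule bern_measure_integral) measurable
    also have "\<dots> = (\<Sum>k\<le>n. bern_mass n k)"
    proof (rule sum.cong[OF refl])
      fix k assume "k \<in> {..n}"
      then show "bern_mass n k * indicator {-2<..1} (2 * (real k / real n) - 1) = bern_mass n k"
        by (simp only: ind[OF bern_node_range] atMost_iff mult_1_right)
    qed
    finally show ?thesis by (simp add: bern_mass_sum)
  qed
  then show "\<exists>a b. a < b \<and> (\<forall>n. 1 - \<epsilon> < measure (bern_measure n) {a<..b})"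
    using \<open>\<epsilon> > 0\<close> by (intro exI[of _ "-2"] exI[of _ 1]) simp
qed

text \<open>Tightness yields a weak limit along a subsequence. Its moments of (1 + t) / 2 are the
  limits in \<open>bern_moment_tendsto\<close>, and a binomial expansion leads back to powers of
  t.\<close>

theorem ex_has_moments: "\<exists>M. has_moments M (\<lambda>n. L ([:0, 1:] ^ n))"
proof -
  obtain r M where r: "strict_mono (r :: nat \<Rightarrow> nat)" and M: "real_distribution M"
    and conv: "weak_conv_m (bern_measure \<circ> id \<circ> r) M"
    using tight_imp_convergent_subsubsequence[OF tight_bern_measure, of id] strict_mono_id by blast
  interpret M: real_distribution M by (rule M)
  have lim: "(\<lambda>n. \<integral>t. f t \<partial>bern_measure (r n)) \<longlonglongrightarrow> (\<integral>t. f t \<partial>M)"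
    if "\<And>x. isCont f x" "\<And>x. \<bar>f x\<bar> \<le> 1" for f :: "real \<Rightarrow> real"
    using weak_conv_imp_integral_bdd_continuous_conv[OF _ M conv, of f 1] that
      real_distribution_bern_measure by (simp add: o_def)
  have AE: "AE t in M. t \<in> {-1..1}"
  proof -
    \<comment> \<open>A bounded continuous function that vanishes exactly on [-1, 1]; its integral
      is 0 along the sequence, hence for the limit.\<close>
    let ?d = "\<lambda>t. min 1 \<bar>t - clamp1 t\<bar>"
    have d0: "(\<integral>t. ?d t \<partial>bern_measure n) = 0" for n
      using bern_node_range[of _ n] by (subst bern_measure_integral) (auto simp: clamp1_eq)
    have "(\<lambda>n. \<integral>t. ?d t \<partial>bern_measure (r n)) \<longlonglongrightarrow> (\<integral>t. ?d t \<partial>M)"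
      by (rule lim) (auto intro!: continuous_intros isCont_clamp1)
    then have "(\<integral>t. ?d t \<partial>M) = 0" by (simp add: d0 LIMSEQ_const_iff)
    moreover have "integrable M ?d" by (rule M.integrable_const_bound[where B=1]) auto
    ultimately have "AE t in M. ?d t = 0"
      by (subst (asm) integral_nonneg_eq_0_iff_AE) auto
    then show ?thesis
    proof eventually_elim
      fix t assume "?d t = 0"
      then have "t = clamp1 t" by (simp add: min_def split: if_splits)
      then show "t \<in> {-1..1}" using clamp1_range[of t] by simp
    qed
  qed
  \<comment> \<open>Using the moments of \<open>M\<close> itself makes the lemmas on
    \<open>has_moments\<close> available before these moments are identified.\<close>
  have M0: "has_moments M (\<lambda>n. \<integral>t. t ^ n \<partial>M)"
    using AE M.prob_space_axioms by (simp add: has_moments_def)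
  have Y_moments: "(\<integral>t. ((1 + t) / 2) ^ j \<partial>M) = L (Y ^ j)" for j
  proof -
    let ?f = "\<lambda>t. ((1 + clamp1 t) / 2) ^ j"
    have "(\<lambda>n. \<integral>t. ?f t \<partial>bern_measure (r n)) \<longlonglongrightarrow> (\<integral>t. ?f t \<partial>M)"
    proof (rule lim)
      show "isCont ?f x" for x by (intro continuous_intros isCont_clamp1) auto
      show "\<bar>?f x\<bar> \<le> 1" for x using clamp1_range[of x] by (auto simp: power_abs intro!: power_le_one)
    qed
    moreover have "(\<integral>t. ?f t \<partial>bern_measure n) = (\<Sum>k\<le>n. bern_mass n k * (real k / real n) ^ j)" for n
      using bern_node_range[of _ n] by (subst bern_measure_integral) (auto simp: clamp1_eq intro!: sum.cong)
    ultimately have "(\<lambda>n. \<Sum>k\<le>r n. bern_mass (r n) k * (real k / real (r n)) ^ j) \<longlonglongrightarrow> (\<integral>t. ?f t \<partial>M)"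
      by simp
    moreover have "(\<lambda>n. \<Sum>k\<le>r n. bern_mass (r n) k * (real k / real (r n)) ^ j) \<longlonglongrightarrow> L (Y ^ j)"
      using LIMSEQ_subseq_LIMSEQ[OF bern_moment_tendsto r] by (simp add: o_def)
    ultimately have "(\<integral>t. ?f t \<partial>M) = L (Y ^ j)" by (rule LIMSEQ_unique)
    moreover have "(\<integral>t. ?f t \<partial>M) = (\<integral>t. ((1 + t) / 2) ^ j \<partial>M)"
      by (rule has_moments_integral_cong[OF M0]) (auto simp: clamp1_eq)
    ultimately show ?thesis by simp
  qed
  have "(\<integral>t. t ^ n \<partial>M) = L ([:0, 1:] ^ n)" for n
  proof -
    \<comment> \<open>The coefficients of (2 y - 1)^n in powers of y. The same expansion is used for
      numbers under the integral and for polynomials under \<open>L\<close>.\<close>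
    let ?c = "\<lambda>i. real (n choose i) * 2 ^ i * (-1) ^ (n - i)"
    have "t ^ n = (\<Sum>i\<le>n. ?c i * ((1 + t) / 2) ^ i)" for t :: real
    proof -
      have "2 * ((1 + t) / 2) + (-1) = t" by (simp add: field_simps)
      then have "t ^ n = (2 * ((1 + t) / 2) + (-1)) ^ n" by simp
      also have "\<dots> = (\<Sum>i\<le>n. ?c i * ((1 + t) / 2) ^ i)"
        unfolding binomial_ring power_mult_distrib by (simp add: mult_ac)
      finally show ?thesis .
    qed
    then have "(\<integral>t. t ^ n \<partial>M) = (\<integral>t. (\<Sum>i\<le>n. ?c i * ((1 + t) / 2) ^ i) \<partial>M)" by simp
    also have "\<dots> = (\<Sum>i\<le>n. ?c i * (\<integral>t. ((1 + t) / 2) ^ i \<partial>M))"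
    proof -
      have "integrable M (\<lambda>t. ((1 + t) / 2) ^ i)" for i
        by (rule has_moments_integrable[OF M0, where B=1]) (auto simp: power_abs intro!: power_le_one)
      then show ?thesis by simp
    qed
    also have "\<dots> = (\<Sum>i\<le>n. ?c i * L (Y ^ i))" by (simp add: Y_moments)
    also have "\<dots> = L ([:0, 1:] ^ n)"
    proof -
      have "[:0, 1:] = Polynomial.smult 2 Y + [:-1:]" by (simp add: Y_def)
      then have "[:0, 1:] ^ n = (\<Sum>i\<le>n. of_nat (n choose i) * (Polynomial.smult 2 Y) ^ i * [:-1:] ^ (n - i))"
        by (simp only: binomial_ring)
      also have "\<dots> = (\<Sum>i\<le>n. Polynomial.smult (?c i) (Y ^ i))"
        by (rule sum.cong) (auto simp: smult_power of_nat_poly poly_const_pow mult_ac)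
      finally show ?thesis by (simp add: L_sum L_smult)
    qed
    finally show ?thesis .
  qed
  then show ?thesis using M0 by auto
qed

end

section \<open>Spectral measures of substochastic kernels\<close>

text \<open>The linear extension of t^n \<mapsto> m n. If m n is the diagonal entry of T^n at
  \<delta>, this is p \<mapsto> <p(T) \<delta>, \<delta>>.\<close>

definition moment_functional :: "(nat \<Rightarrow> real) \<Rightarrow> real poly \<Rightarrow> real" where
  "moment_functional m p = (\<Sum>i\<le>degree p. coeff p i * m i)"

lemma moment_functional_le:
  "degree p \<le> N \<Longrightarrow> moment_functional m p = (\<Sum>i\<le>N. coeff p i * m i)"
  unfolding moment_functional_def
  by (rule sum.mono_neutral_left) (auto simp: coeff_eq_0 not_le)

lemma moment_functional_add: "moment_functional m (p + q) = moment_functional m p + moment_functional m q"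
proof -
  let ?N = "max (degree p) (degree q)"
  have "moment_functional m (p + q) = (\<Sum>i\<le>?N. coeff (p + q) i * m i)"
    by (rule moment_functional_le) (rule degree_add_le_max)
  then show ?thesis
    by (simp add: moment_functional_le[of p ?N] moment_functional_le[of q ?N] ring_distribs sum.distrib)
qed

lemma moment_functional_smult: "moment_functional m (Polynomial.smult c p) = c * moment_functional m p"
  by (subst moment_functional_le[of _ "degree p"])
    (auto simp: moment_functional_def sum_distrib_left mult_ac intro: degree_smult_le)

lemma moment_functional_monom: "moment_functional m (monom c n) = c * m n"
proof -
  have "moment_functional m (monom c n) = (\<Sum>i\<le>n. coeff (monom c n) i * m i)"
    by (rule moment_functional_le) (rule degree_monom_le)
  also have "\<dots> = (\<Sum>i\<le>n. if i = n then c * m n else 0)"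
    by (rule sum.cong) auto
  finally show ?thesis by simp
qed

lemma moment_functional_sum:
  "moment_functional m (\<Sum>i\<in>I. p i) = (\<Sum>i\<in>I. moment_functional m (p i))"
proof -
  have "moment_functional m 0 = 0" by (simp add: moment_functional_def)
  then show ?thesis
    by (induction I rule: infinite_finite_induct) (auto simp: moment_functional_add)
qed

lemma poly_square_monoms:
  "p * p = (\<Sum>i\<le>degree p. \<Sum>j\<le>degree p. monom (coeff p i * coeff p j) (i + j))"
proof -
  have "p * p = (\<Sum>i\<le>degree p. monom (coeff p i) i) * (\<Sum>j\<le>degree p. monom (coeff p j) j)"
    by (simp add: poly_as_sum_of_monoms)
  then show ?thesis by (simp add: sum_product mult_monom)
qed

lemma moment_functional_square:
  "moment_functional m (p * p) = (\<Sum>i\<le>degree p. \<Sum>j\<le>degree p. coeff p i * coeff p j * m (i + j))"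
  unfolding poly_square_monoms by (simp add: moment_functional_sum moment_functional_monom)

text \<open>The index \<open>Suc i + Suc j\<close> lets the subtracted part be read as the squared
  norm of T p(T) \<delta>, so that the claim of positivity becomes contractivity of T.\<close>

lemma moment_functional_weighted_square:
  "moment_functional m ([:1, 0, -1:] * (p * p)) =
     (\<Sum>i\<le>degree p. \<Sum>j\<le>degree p. coeff p i * coeff p j * (m (i + j) - m (Suc i + Suc j)))"
proof -
  have w: "[:1, 0, -1:] = monom 1 0 + monom (-1 :: real) 2"
    by (simp add: monom_0 monom_altdef numeral_2_eq_2)
  have "[:1, 0, -1:] * (p * p) = (\<Sum>i\<le>degree p. \<Sum>j\<le>degree p.
      monom (coeff p i * coeff p j) (i + j) + monom (- (coeff p i * coeff p j)) (Suc i + Suc j))"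
    unfolding w poly_square_monoms by (simp add: distrib_right mult_monom sum_distrib_left)
  then show ?thesis
    by (simp add: moment_functional_sum moment_functional_monom moment_functional_add right_diff_distrib)
qed

section \<open>Symmetric substochastic kernels as contractions\<close>

lemma weighted_square_le:
  fixes k u :: "'a \<Rightarrow> real"
  assumes "finite B" "\<And>y. y \<in> B \<Longrightarrow> 0 \<le> k y" "(\<Sum>y\<in>B. k y) \<le> 1"
  shows "(\<Sum>y\<in>B. k y * u y)\<^sup>2 \<le> (\<Sum>y\<in>B. k y * (u y)\<^sup>2)"
proof -
  have "(\<Sum>y\<in>B. k y * u y)\<^sup>2 = (\<Sum>y\<in>B. sqrt (k y) * (sqrt (k y) * u y))\<^sup>2"
    using assms(2) by (intro arg_cong[where f="\<lambda>x. x\<^sup>2"] sum.cong) auto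
  also have "\<dots> \<le> (\<Sum>y\<in>B. (sqrt (k y))\<^sup>2) * (\<Sum>y\<in>B. (sqrt (k y) * u y)\<^sup>2)"
    by (rule Cauchy_Schwarz_ineq_sum)
  also have "\<dots> = (\<Sum>y\<in>B. k y) * (\<Sum>y\<in>B. k y * (u y)\<^sup>2)"
    using assms(2) by (simp add: power_mult_distrib)
  also have "\<dots> \<le> 1 * (\<Sum>y\<in>B. k y * (u y)\<^sup>2)"
    using assms by (intro mult_right_mono sum_nonneg) auto
  finally show ?thesis by simp
qed

text \<open>A Schur test: weighted Cauchy-Schwarz in each row, then exchange of the sums; by
  symmetry the column sums are at most 1 as well.\<close>

lemma substochastic_contraction:
  fixes k :: "'a \<Rightarrow> 'a \<Rightarrow> real"
  assumes B: "finite B" and nonneg: "\<And>x y. x \<in> B \<Longrightarrow> y \<in> B \<Longrightarrow> 0 \<le> k x y"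
    and sym: "\<And>x y. x \<in> B \<Longrightarrow> y \<in> B \<Longrightarrow> k x y = k y x"
    and sub: "\<And>x. x \<in> B \<Longrightarrow> (\<Sum>y\<in>B. k x y) \<le> 1"
  shows "(\<Sum>x\<in>B. (\<Sum>y\<in>B. k x y * u y)\<^sup>2) \<le> (\<Sum>x\<in>B. (u x)\<^sup>2)"
proof -
  have "(\<Sum>x\<in>B. (\<Sum>y\<in>B. k x y * u y)\<^sup>2) \<le> (\<Sum>x\<in>B. \<Sum>y\<in>B. k x y * (u y)\<^sup>2)"
    using assms by (intro sum_mono weighted_square_le) auto
  also have "\<dots> = (\<Sum>y\<in>B. (\<Sum>x\<in>B. k y x) * (u y)\<^sup>2)"
    by (subst sum.swap) (auto simp: sum_distrib_right sym intro!: sum.cong)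
  also have "\<dots> \<le> (\<Sum>y\<in>B. 1 * (u y)\<^sup>2)"
    using sub by (intro sum_mono mult_right_mono) auto
  finally show ?thesis by simp
qed

locale substochastic_kernel =
  fixes V :: "'a set" and k :: "'a \<Rightarrow> 'a \<Rightarrow> real" and x0 :: 'a
  assumes nonneg: "x \<in> V \<Longrightarrow> y \<in> V \<Longrightarrow> 0 \<le> k x y"
    and sym: "x \<in> V \<Longrightarrow> y \<in> V \<Longrightarrow> k x y = k y x"
    and finite_range: "x \<in> V \<Longrightarrow> finite {y \<in> V. k x y \<noteq> 0}"
    and row_sum: "x \<in> V \<Longrightarrow> (\<Sum>y\<in>{y \<in> V. k x y \<noteq> 0}. k x y) \<le> 1"
    and x0: "x0 \<in> V"
begin

definition kernel_op :: "('a \<Rightarrow> real) \<Rightarrow> 'a \<Rightarrow> real" where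
  "kernel_op f = (\<lambda>x. \<Sum>\<^sub>\<infinity>y\<in>V. k x y * f y)"

abbreviation v :: "nat \<Rightarrow> 'a \<Rightarrow> real" where
  "v n \<equiv> (kernel_op ^^ n) (indicator {x0})"

text \<open>By symmetry, a point charged at step n + 1 lies in the row of a point charged at step n,
  and rows are finite.\<close>

lemma finite_support: "finite {x \<in> V. v n x \<noteq> 0}"
proof (induction n)
  case 0
  have "{x \<in> V. v 0 x \<noteq> 0} \<subseteq> {x0}" by (auto simp: indicator_def split: if_splits)
  then show ?case by (rule finite_subset) simp
next
  case (Suc n)
  have "{x \<in> V. v (Suc n) x \<noteq> 0} \<subseteq> (\<Union>y\<in>{y \<in> V. v n y \<noteq> 0}. {x \<in> V. k y x \<noteq> 0})"
  proof
    fix x assume x: "x \<in> {x \<in> V. v (Suc n) x \<noteq> 0}"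
    then have "(\<Sum>\<^sub>\<infinity>y\<in>V. k x y * v n y) \<noteq> 0" by (simp add: kernel_op_def)
    then obtain y where "y \<in> V" "k x y * v n y \<noteq> 0" using infsum_0[of V "\<lambda>y. k x y * v n y"] by blast
    then show "x \<in> (\<Union>y\<in>{y \<in> V. v n y \<noteq> 0}. {x \<in> V. k y x \<noteq> 0})"
      using x sym[of x y] by auto
  qed
  then show ?case by (rule finite_subset) (use Suc finite_range in auto)
qed

text \<open>One finite set that carries the iterates up to \<open>N\<close>, so that l2 inner
  products and the operator itself become finite sums.\<close>

definition reach :: "nat \<Rightarrow> 'a set" where
  "reach N = insert x0 (\<Union>n\<le>N. {x \<in> V. v n x \<noteq> 0})"

lemma finite_reach: "finite (reach N)" and reach_subset: "reach N \<subseteq> V"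
  using finite_support x0 by (auto simp: reach_def)

lemma v_Suc: 
  assumes "n \<le> N" shows "v (Suc n) x = (\<Sum>y\<in>reach N. k x y * v n y)"
proof -
  have "v (Suc n) x = (\<Sum>\<^sub>\<infinity>y\<in>V. k x y * v n y)" by (simp add: kernel_op_def)
  also have "\<dots> = (\<Sum>\<^sub>\<infinity>y\<in>reach N. k x y * v n y)"
    using assms reach_subset by (intro infsum_cong_neutral) (auto simp: reach_def)
  finally show ?thesis by (simp add: finite_reach)
qed

text \<open>Self-adjointness moves the applications of the kernel one by one from the second factor
  to the first; the induction therefore generalizes i.\<close>

lemma inner_product_moments:
  assumes "i + j \<le> N"
  shows "(\<Sum>x\<in>reach N. v i x * v j x) = v (i + j) x0"
  using assms
proof (induction j arbitrary: i)
  case 0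
  have "(\<Sum>x\<in>reach N. v i x * v 0 x) = (\<Sum>x\<in>reach N. if x = x0 then v i x else 0)"
    by (rule sum.cong) (auto simp: indicator_def)
  also have "\<dots> = v i x0" using finite_reach by (simp add: reach_def)
  finally show ?case by simp
next
  case (Suc j)
  have "(\<Sum>x\<in>reach N. v i x * v (Suc j) x) = (\<Sum>x\<in>reach N. \<Sum>y\<in>reach N. k x y * v i x * v j y)"
    using Suc.prems by (simp add: v_Suc[of j N] sum_distrib_left mult_ac del: funpow.simps)
  also have "\<dots> = (\<Sum>y\<in>reach N. \<Sum>x\<in>reach N. k y x * v i x * v j y)"
  proof (subst sum.swap, intro sum.cong refl)
    fix x y assume "x \<in> reach N" "y \<in> reach N"
    then have "k x y = k y x" using reach_subset by (intro sym) auto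
    then show "k x y * v i x * v j y = k y x * v i x * v j y" by simp
  qed
  also have "\<dots> = (\<Sum>y\<in>reach N. v (Suc i) y * v j y)"
    using Suc.prems by (simp add: v_Suc[of i N] sum_distrib_left sum_distrib_right mult_ac del: funpow.simps)
  also have "\<dots> = v (Suc i + j) x0" by (rule Suc.IH) (use Suc.prems in simp)
  finally show ?case by (simp del: funpow.simps)
qed

text \<open>Used with a = 0 for the squared norm of p(T) \<delta> and with a = 1 for that of T p(T)
  \<delta>.\<close>

lemma square_sum_moments:
  assumes "d + d + 2 * a \<le> N"
  shows "(\<Sum>x\<in>reach N. (\<Sum>i\<le>d. c i * v (i + a) x)\<^sup>2) = (\<Sum>i\<le>d. \<Sum>j\<le>d. c i * c j * v ((i + a) + (j + a)) x0)"
proof -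
  have "(\<Sum>x\<in>reach N. (\<Sum>i\<le>d. c i * v (i + a) x)\<^sup>2)
      = (\<Sum>x\<in>reach N. \<Sum>i\<le>d. \<Sum>j\<le>d. c i * c j * (v (i + a) x * v (j + a) x))"
    by (simp add: power2_eq_square sum_product mult_ac)
  also have "\<dots> = (\<Sum>i\<le>d. \<Sum>j\<le>d. \<Sum>x\<in>reach N. c i * c j * (v (i + a) x * v (j + a) x))"
    by (subst sum.swap, rule sum.cong[OF refl], rule sum.swap)
  also have "\<dots> = (\<Sum>i\<le>d. \<Sum>j\<le>d. c i * c j * v ((i + a) + (j + a)) x0)"
    by (intro sum.cong refl) (use assms in \<open>simp add: sum_distrib_left[symmetric] inner_product_moments\<close>)
  finally show ?thesis .
qed

lemma row_sum_le:
  assumes "finite B" "B \<subseteq> V" "x \<in> V" shows "(\<Sum>y\<in>B. k x y) \<le> 1"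
proof -
  have "(\<Sum>y\<in>B. k x y) = (\<Sum>y\<in>{y \<in> B. k x y \<noteq> 0}. k x y)"
    using assms by (intro sum.mono_neutral_right) auto
  also have "\<dots> \<le> (\<Sum>y\<in>{y \<in> V. k x y \<noteq> 0}. k x y)"
    using assms finite_range nonneg by (intro sum_mono2) auto
  finally show ?thesis using row_sum[OF assms(3)] by simp
qed

lemma moments_positive: "positive_functional (moment_functional (\<lambda>n. v n x0))"
proof
  let ?L = "moment_functional (\<lambda>n. v n x0)"
  fix p :: "real poly"
  define d where "d = degree p"
  \<comment> \<open>The highest moment that occurs, in the squared norm of T p(T) \<delta>, has
    index 2 (d + 1).\<close>
  define N where "N = d + d + 2"
  define u where "u x = (\<Sum>i\<le>d. coeff p i * v i x)" for x
  have u: "(\<Sum>x\<in>reach N. (u x)\<^sup>2) = (\<Sum>i\<le>d. \<Sum>j\<le>d. coeff p i * coeff p j * v (i + j) x0)"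
    using square_sum_moments[of d 0 N "coeff p"] by (simp add: u_def N_def)
  show "0 \<le> ?L (p * p)"
    unfolding moment_functional_square d_def[symmetric] u[symmetric] by (simp add: sum_nonneg)
  have Tu: "(\<Sum>y\<in>reach N. k x y * u y) = (\<Sum>i\<le>d. coeff p i * v (i + 1) x)" for x
  proof -
    have "(\<Sum>y\<in>reach N. k x y * u y) = (\<Sum>i\<le>d. coeff p i * (\<Sum>y\<in>reach N. k x y * v i y))"
      unfolding u_def sum_distrib_left by (subst sum.swap) (simp add: mult_ac)
    also have "\<dots> = (\<Sum>i\<le>d. coeff p i * v (i + 1) x)"
      by (rule sum.cong) (auto simp: v_Suc[of _ N] N_def simp del: funpow.simps)
    finally show ?thesis .
  qed
  \<comment> \<open>Restriction to \<open>reach N\<close> keeps the kernel symmetric and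
    substochastic, and by \<open>Tu\<close> the restricted kernel still acts on u as T does.\<close>
  have "(\<Sum>x\<in>reach N. (\<Sum>y\<in>reach N. k x y * u y)\<^sup>2) \<le> (\<Sum>x\<in>reach N. (u x)\<^sup>2)"
    using finite_reach reach_subset
    by (intro substochastic_contraction row_sum_le nonneg sym) blast+
  then have "(\<Sum>i\<le>d. \<Sum>j\<le>d. coeff p i * coeff p j * v (Suc i + Suc j) x0)
     \<le> (\<Sum>i\<le>d. \<Sum>j\<le>d. coeff p i * coeff p j * v (i + j) x0)"
    unfolding Tu u using square_sum_moments[of d 1 N "coeff p"] by (simp add: N_def del: funpow.simps)
  then show "0 \<le> ?L ([:1, 0, -1:] * (p * p))"
    unfolding moment_functional_weighted_square d_def[symmetric]
    by (simp add: right_diff_distrib sum_subtractf del: funpow.simps)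
next
  show "moment_functional (\<lambda>n. v n x0) 1 = 1" by (simp add: moment_functional_def)
qed (auto simp: moment_functional_add moment_functional_smult)

theorem has_moments_diagonal_spectral_measure:
  "has_moments (diagonal_spectral_measure kernel_op x0) (\<lambda>n. v n x0)"
proof -
  interpret positive_functional "moment_functional (\<lambda>n. v n x0)" by (rule moments_positive)
  have "[:0, 1:] ^ n = monom (1::real) n" for n by (simp add: monom_altdef)
  then obtain M where "has_moments M (\<lambda>n. v n x0)"
    using ex_has_moments by (auto simp: moment_functional_monom)
  then show ?thesis using diagonal_spectral_measure_eqI[of M kernel_op x0] by simp
qed

end

section \<open>The walk on a percolation cluster\<close>

locale cayley_walk = group G for G :: "('a, 'c) monoid_scheme" (structure) +
  fixes \<mu> :: "'a pmf"
  assumes support_subset: "set_pmf \<mu> \<subseteq> carrier G"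
    and finite_set_pmf: "finite (set_pmf \<mu>)"
    and symmetric: "x \<in> carrier G \<Longrightarrow> pmf \<mu> (inv x) = pmf \<mu> x"
begin

abbreviation edges :: "'a set set" where
  "edges \<equiv> cayley_edges G (set_pmf \<mu>)"

definition step :: "'a \<Rightarrow> 'a \<Rightarrow> real" where
  "step x y = pmf \<mu> (inv x \<otimes> y)"

definition nbs :: "'a \<Rightarrow> 'a set" where
  "nbs x = {y \<in> carrier G. step x y \<noteq> 0}"

lemma step_nonneg: "0 \<le> step x y" by (simp add: step_def)

lemma step_sym: "x \<in> carrier G \<Longrightarrow> y \<in> carrier G \<Longrightarrow> step x y = step y x"
  using symmetric[of "inv x \<otimes> y"] by (simp add: step_def inv_mult_group)

lemma nbs_subset: "nbs x \<subseteq> carrier G" by (auto simp: nbs_def)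

lemma in_nbs: "x \<in> carrier G \<Longrightarrow> y \<in> carrier G \<Longrightarrow> y \<in> nbs x \<longleftrightarrow> inv x \<otimes> y \<in> set_pmf \<mu>"
  by (simp add: nbs_def step_def set_pmf_iff)

lemma mult_inv_cancel: "x \<in> carrier G \<Longrightarrow> y \<in> carrier G \<Longrightarrow> x \<otimes> (inv x \<otimes> y) = y"
  by (simp add: m_assoc[symmetric])

lemma edge_if_nbs: "x \<in> carrier G \<Longrightarrow> y \<in> nbs x \<Longrightarrow> {x, y} \<in> edges"
proof -
  assume x: "x \<in> carrier G" and y: "y \<in> nbs x"
  then have "y \<in> carrier G" "inv x \<otimes> y \<in> set_pmf \<mu>" using in_nbs nbs_subset by auto
  then show ?thesis using x mult_inv_cancel[of x y] unfolding cayley_edges_def by force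
qed

lemma nbs_inj: "x \<in> carrier G \<Longrightarrow> inj_on (\<lambda>y. inv x \<otimes> y) (nbs x)"
  using nbs_subset by (intro inj_onI) (metis mult_inv_cancel subsetD)

lemma nbs_image: "x \<in> carrier G \<Longrightarrow> (\<lambda>y. inv x \<otimes> y) ` nbs x \<subseteq> set_pmf \<mu>"
  using nbs_subset in_nbs by blast

lemma finite_nbs: "x \<in> carrier G \<Longrightarrow> finite (nbs x)"
  by (rule inj_on_finite[OF nbs_inj nbs_image finite_set_pmf])

lemma step_sum_le: assumes "x \<in> carrier G" shows "(\<Sum>y\<in>nbs x. step x y) \<le> 1"
proof -
  have "(\<Sum>y\<in>nbs x. step x y) = (\<Sum>s\<in>(\<lambda>y. inv x \<otimes> y) ` nbs x. pmf \<mu> s)"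
    by (simp add: sum.reindex[OF nbs_inj[OF assms]] step_def)
  also have "\<dots> \<le> (\<Sum>s\<in>set_pmf \<mu>. pmf \<mu> s)"
    using nbs_image[OF assms] finite_set_pmf by (intro sum_mono2) auto
  finally show ?thesis by (simp add: sum_pmf_eq_1 finite_set_pmf)
qed

text \<open>The walk is killed at closed edges without mention of the cluster. As a finite recursion
  over neighbours it is visibly measurable in \<omega>; \<open>subgraph_operator_power\<close>
  relates it to the cluster operator.\<close>

fun walk :: "('a set \<Rightarrow> bool) \<Rightarrow> nat \<Rightarrow> 'a \<Rightarrow> real" where
  "walk \<omega> 0 x = indicator {\<one>} x"
| "walk \<omega> (Suc n) x = (\<Sum>y\<in>nbs x. (if \<omega> {x, y} then step x y else 0) * walk \<omega> n y)"

lemma walk_bound: "x \<in> carrier G \<Longrightarrow> \<bar>walk \<omega> n x\<bar> \<le> 1"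
proof (induction n arbitrary: x)
  case 0
  then show ?case by (simp add: indicator_def)
next
  case (Suc n)
  have "\<bar>walk \<omega> (Suc n) x\<bar> \<le> (\<Sum>y\<in>nbs x. \<bar>(if \<omega> {x, y} then step x y else 0) * walk \<omega> n y\<bar>)"
    by simp
  also have "\<dots> \<le> (\<Sum>y\<in>nbs x. step x y * 1)"
  proof (rule sum_mono)
    fix y assume "y \<in> nbs x"
    then have "\<bar>walk \<omega> n y\<bar> \<le> 1" using Suc.IH nbs_subset by blast
    then show "\<bar>(if \<omega> {x, y} then step x y else 0) * walk \<omega> n y\<bar> \<le> step x y * 1"
      unfolding abs_mult by (intro mult_mono) (auto simp: step_nonneg)
  qed
  also have "\<dots> \<le> 1" using step_sum_le[OF Suc.prems] by simp
  finally show ?case .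
qed

text \<open>A nonzero weight requires an open path from x to the identity.\<close>

lemma walk_support: "walk \<omega> n x \<noteq> 0 \<Longrightarrow> x \<in> carrier G \<Longrightarrow> x \<in> cluster_vertices G (set_pmf \<mu>) \<omega>"
proof (induction n arbitrary: x)
  case 0
  then show ?case by (simp add: cluster_vertices_def indicator_def split: if_splits)
next
  case (Suc n)
  then obtain y where y: "y \<in> nbs x" "(if \<omega> {x, y} then step x y else 0) * walk \<omega> n y \<noteq> 0"
    by (auto elim: sum.not_neutral_contains_not_neutral)
  then have "y \<in> cluster_vertices G (set_pmf \<mu>) \<omega>" "\<omega> {x, y}"
    using Suc.IH nbs_subset by (auto split: if_splits)
  moreover have "{x, y} \<in> edges" using y Suc.prems edge_if_nbs by blast
  ultimately show ?case
    by (auto simp: cluster_vertices_def insert_commute elim!: rtrancl_into_rtrancl)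
qed

lemma in_cluster_edges:
  assumes "y \<in> cluster_vertices G (set_pmf \<mu>) \<omega>"
  shows "{x, y} \<in> cluster_edges G (set_pmf \<mu>) \<omega> \<longleftrightarrow> {x, y} \<in> edges \<and> \<omega> {x, y}"
proof
  assume "{x, y} \<in> edges \<and> \<omega> {x, y}"
  moreover from this have "x \<in> cluster_vertices G (set_pmf \<mu>) \<omega>"
    using assms by (auto simp: cluster_vertices_def insert_commute elim!: rtrancl_into_rtrancl)
  ultimately show "{x, y} \<in> cluster_edges G (set_pmf \<mu>) \<omega>" using assms by (simp add: cluster_edges_def)
qed (simp add: cluster_edges_def)

text \<open>The two recursions differ only at open edges outside the cluster, and there the weight
  of the far endpoint is 0 by \<open>walk_support\<close>.\<close>

lemma subgraph_operator_power:
  assumes "x \<in> carrier G"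
  shows "(subgraph_operator G \<mu> (cluster_edges G (set_pmf \<mu>) \<omega>) ^^ n) (indicator {\<one>}) x = walk \<omega> n x"
  using assms
proof (induction n arbitrary: x)
  case 0
  then show ?case by simp
next
  case (Suc n)
  let ?P = "subgraph_operator G \<mu> (cluster_edges G (set_pmf \<mu>) \<omega>)"
  have "(?P ^^ Suc n) (indicator {\<one>}) x =
      (\<Sum>\<^sub>\<infinity>y\<in>carrier G. (if {x, y} \<in> cluster_edges G (set_pmf \<mu>) \<omega> then step x y else 0) * (?P ^^ n) (indicator {\<one>}) y)"
    by (simp add: subgraph_operator_def step_def cong: if_cong)
  also have "\<dots> = (\<Sum>\<^sub>\<infinity>y\<in>nbs x. (if \<omega> {x, y} then step x y else 0) * walk \<omega> n y)"
  proof (rule infsum_cong_neutral)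
    fix y assume "y \<in> carrier G - nbs x"
    then show "(if {x, y} \<in> cluster_edges G (set_pmf \<mu>) \<omega> then step x y else 0) * (?P ^^ n) (indicator {\<one>}) y = 0"
      by (auto simp: nbs_def)
  next
    fix y assume "y \<in> carrier G \<inter> nbs x"
    then have y: "y \<in> carrier G" "y \<in> nbs x" by auto
    have "{x, y} \<in> cluster_edges G (set_pmf \<mu>) \<omega> \<longleftrightarrow> \<omega> {x, y}" if "walk \<omega> n y \<noteq> 0"
      using in_cluster_edges[OF walk_support[OF that y(1)]] edge_if_nbs[OF Suc.prems y(2)] by blast
    then show "(if {x, y} \<in> cluster_edges G (set_pmf \<mu>) \<omega> then step x y else 0) * (?P ^^ n) (indicator {\<one>}) y
        = (if \<omega> {x, y} then step x y else 0) * walk \<omega> n y"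
      using Suc.IH[OF y(1)] by (cases "walk \<omega> n y = 0") auto
  qed (use nbs_subset in auto)
  also have "\<dots> = walk \<omega> (Suc n) x" using finite_nbs[OF Suc.prems] by simp
  finally show ?case .
qed

text \<open>Deleting edges only lowers the row sums, and edges are unordered, so for every \<omega>
  the kernel stays symmetric and substochastic.\<close>

lemma has_moments_cluster_spectral_measure:
  "has_moments (cluster_spectral_measure G \<mu> \<omega>) (\<lambda>n. walk \<omega> n \<one>)"
proof -
  let ?E = "cluster_edges G (set_pmf \<mu>) \<omega>"
  interpret substochastic_kernel "carrier G" "\<lambda>x y. if {x, y} \<in> ?E then step x y else 0" \<one>
  proof
    fix x assume x: "x \<in> carrier G"
    have sub: "{y \<in> carrier G. (if {x, y} \<in> ?E then step x y else 0) \<noteq> 0} \<subseteq> nbs x"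
      by (auto simp: nbs_def)
    then show "finite {y \<in> carrier G. (if {x, y} \<in> ?E then step x y else 0) \<noteq> 0}"
      using finite_nbs[OF x] by (rule finite_subset)
    have "(\<Sum>y\<in>{y \<in> carrier G. (if {x, y} \<in> ?E then step x y else 0) \<noteq> 0}. if {x, y} \<in> ?E then step x y else 0)
        \<le> (\<Sum>y\<in>{y \<in> carrier G. (if {x, y} \<in> ?E then step x y else 0) \<noteq> 0}. step x y)"
      by (rule sum_mono) (simp add: step_nonneg)
    also have "\<dots> \<le> (\<Sum>y\<in>nbs x. step x y)"
      by (rule sum_mono2[OF finite_nbs[OF x] sub]) (rule step_nonneg)
    finally show "(\<Sum>y\<in>{y \<in> carrier G. (if {x, y} \<in> ?E then step x y else 0) \<noteq> 0}. if {x, y} \<in> ?E then step x y else 0) \<le> 1"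
      using step_sum_le[OF x] by simp
  qed (auto simp: step_nonneg step_sym insert_commute)
  have op: "kernel_op = subgraph_operator G \<mu> ?E"
    unfolding kernel_op_def unfolding subgraph_operator_def step_def ..
  show ?thesis
    using has_moments_diagonal_spectral_measure
    by (simp add: op subgraph_operator_power cluster_spectral_measure_def)
qed

end

section \<open>The lamplighter group\<close>

locale lamplighter = cayley_walk G \<mu> + H: group H
  for G :: "('a, 'c) monoid_scheme" (structure) and \<mu> :: "'a pmf"
    and H :: "('h, 'd) monoid_scheme" +
  assumes finite_H: "finite (carrier H)" and card_H: "card (carrier H) \<ge> 2"
begin

abbreviation lamps :: "('a set \<Rightarrow> 'h) set" where
  "lamps \<equiv> carrier (lamp_group G (set_pmf \<mu>) H)"

definition edge_shift :: "'a \<Rightarrow> 'a set \<Rightarrow> 'a set" where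
  "edge_shift g \<epsilon> = (\<lambda>x. g \<otimes> x) ` \<epsilon>"

lemma edge_shift_edge: assumes "g \<in> carrier G" "\<epsilon> \<in> edges" shows "edge_shift g \<epsilon> \<in> edges"
proof -
  obtain x s where x: "\<epsilon> = {x, x \<otimes> s}" "x \<in> carrier G" "s \<in> set_pmf \<mu>"
    using assms(2) by (auto simp: cayley_edges_def)
  then have "edge_shift g \<epsilon> = {g \<otimes> x, (g \<otimes> x) \<otimes> s}"
    using assms(1) support_subset by (auto simp: edge_shift_def m_assoc)
  then show ?thesis using x assms(1) unfolding cayley_edges_def by blast
qed

lemma edge_shift_mult:
  "g \<in> carrier G \<Longrightarrow> h \<in> carrier G \<Longrightarrow> \<epsilon> \<in> edges \<Longrightarrow> edge_shift g (edge_shift h \<epsilon>) = edge_shift (g \<otimes> h) \<epsilon>"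
  using support_subset
  by (auto simp: edge_shift_def image_image m_assoc cayley_edges_def subset_iff)

lemma edge_shift_one: "\<epsilon> \<in> edges \<Longrightarrow> edge_shift \<one> \<epsilon> = \<epsilon>"
  using support_subset by (auto simp: edge_shift_def cayley_edges_def subset_iff)

lemma lamp_action_apply:
  "\<epsilon> \<in> edges \<Longrightarrow> lamp_action G (set_pmf \<mu>) g \<eta> \<epsilon> = \<eta> (edge_shift (inv g) \<epsilon>)"
  by (simp add: lamp_action_def edge_shift_def)

lemma in_lamps:
  "\<eta> \<in> lamps \<longleftrightarrow> \<eta> \<in> edges \<rightarrow>\<^sub>E carrier H \<and> finite {\<epsilon> \<in> edges. \<eta> \<epsilon> \<noteq> \<one>\<^bsub>H\<^esub>}"
  by (simp add: lamp_group_def carrier_sum_group H.group_axioms)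

lemma lampsI:
  assumes "\<And>\<epsilon>. \<epsilon> \<in> edges \<Longrightarrow> \<eta> \<epsilon> \<in> carrier H" "\<eta> \<in> extensional edges"
    and "{\<epsilon> \<in> edges. \<eta> \<epsilon> \<noteq> \<one>\<^bsub>H\<^esub>} \<subseteq> S" "finite S"
  shows "\<eta> \<in> lamps"
  using assms finite_subset by (auto simp: in_lamps PiE_iff)

lemma lamps_apply: "\<eta> \<in> lamps \<Longrightarrow> \<epsilon> \<in> edges \<Longrightarrow> \<eta> \<epsilon> \<in> carrier H"
  by (auto simp: in_lamps PiE_iff)

lemma lamps_eqI: "\<eta> \<in> lamps \<Longrightarrow> \<eta>' \<in> lamps \<Longrightarrow> (\<And>\<epsilon>. \<epsilon> \<in> edges \<Longrightarrow> \<eta> \<epsilon> = \<eta>' \<epsilon>) \<Longrightarrow> \<eta> = \<eta>'"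
  by (auto simp: in_lamps intro: PiE_ext)

lemma lamps_finite_support: "\<eta> \<in> lamps \<Longrightarrow> finite {\<epsilon> \<in> edges. \<eta> \<epsilon> \<noteq> \<one>\<^bsub>H\<^esub>}"
  by (simp add: in_lamps)

abbreviation K :: "(('a set \<Rightarrow> 'h) \<times> 'a) monoid" where
  "K \<equiv> lamp_semidirect G (set_pmf \<mu>) H"

lemma carrier_K: "carrier K = lamps \<times> carrier G" by (simp add: lamp_semidirect_def)

lemma one_K: "\<one>\<^bsub>K\<^esub> = (\<lambda>\<epsilon>\<in>edges. \<one>\<^bsub>H\<^esub>, \<one>)"
  by (simp add: lamp_semidirect_def lamp_group_def)

lemma mult_K:
  "(\<eta>, g) \<otimes>\<^bsub>K\<^esub> (\<eta>', g') = (\<lambda>\<epsilon>\<in>edges. \<eta> \<epsilon> \<otimes>\<^bsub>H\<^esub> \<eta>' (edge_shift (inv g) \<epsilon>), g \<otimes> g')"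
  by (auto simp: lamp_semidirect_def lamp_group_def lamp_action_apply intro!: restrict_ext)

lemma support_translate:
  assumes "g \<in> carrier G"
  shows "{\<epsilon> \<in> edges. \<eta> (edge_shift g \<epsilon>) \<noteq> c} \<subseteq> edge_shift (inv g) ` {\<epsilon> \<in> edges. \<eta> \<epsilon> \<noteq> c}"
proof
  fix \<epsilon> assume e: "\<epsilon> \<in> {\<epsilon> \<in> edges. \<eta> (edge_shift g \<epsilon>) \<noteq> c}"
  then have "\<epsilon> = edge_shift (inv g) (edge_shift g \<epsilon>)" using assms by (simp add: edge_shift_mult edge_shift_one)
  then show "\<epsilon> \<in> edge_shift (inv g) ` {\<epsilon> \<in> edges. \<eta> \<epsilon> \<noteq> c}" using e assms edge_shift_edge by blast
qed

lemma mult_lamps: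
  assumes "\<eta> \<in> lamps" "\<eta>' \<in> lamps" "g \<in> carrier G"
  shows "(\<lambda>\<epsilon>\<in>edges. \<eta> \<epsilon> \<otimes>\<^bsub>H\<^esub> \<eta>' (edge_shift (inv g) \<epsilon>)) \<in> lamps"
proof (rule lampsI[where S="{\<epsilon> \<in> edges. \<eta> \<epsilon> \<noteq> \<one>\<^bsub>H\<^esub>} \<union> edge_shift (inv (inv g)) ` {\<epsilon> \<in> edges. \<eta>' \<epsilon> \<noteq> \<one>\<^bsub>H\<^esub>}"])
  show "{\<epsilon> \<in> edges. (\<lambda>\<epsilon>\<in>edges. \<eta> \<epsilon> \<otimes>\<^bsub>H\<^esub> \<eta>' (edge_shift (inv g) \<epsilon>)) \<epsilon> \<noteq> \<one>\<^bsub>H\<^esub>}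
     \<subseteq> {\<epsilon> \<in> edges. \<eta> \<epsilon> \<noteq> \<one>\<^bsub>H\<^esub>} \<union> edge_shift (inv (inv g)) ` {\<epsilon> \<in> edges. \<eta>' \<epsilon> \<noteq> \<one>\<^bsub>H\<^esub>}"
    using support_translate[of "inv g" \<eta>' "\<one>\<^bsub>H\<^esub>"] assms by auto
qed (use assms lamps_finite_support in \<open>auto simp: lamps_apply edge_shift_edge\<close>)

lemma inverse_lamps:
  assumes "\<eta> \<in> lamps" "g \<in> carrier G"
  shows "(\<lambda>\<epsilon>\<in>edges. inv\<^bsub>H\<^esub> \<eta> (edge_shift g \<epsilon>)) \<in> lamps"
proof (rule lampsI[where S="edge_shift (inv g) ` {\<epsilon> \<in> edges. \<eta> \<epsilon> \<noteq> \<one>\<^bsub>H\<^esub>}"])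
  show "{\<epsilon> \<in> edges. (\<lambda>\<epsilon>\<in>edges. inv\<^bsub>H\<^esub> \<eta> (edge_shift g \<epsilon>)) \<epsilon> \<noteq> \<one>\<^bsub>H\<^esub>} \<subseteq> edge_shift (inv g) ` {\<epsilon> \<in> edges. \<eta> \<epsilon> \<noteq> \<one>\<^bsub>H\<^esub>}"
    using support_translate[of g \<eta> "\<one>\<^bsub>H\<^esub>"] assms by auto
qed (use assms lamps_finite_support in \<open>auto simp: lamps_apply edge_shift_edge\<close>)

lemma left_inverse_K:
  assumes "\<eta> \<in> lamps" "g \<in> carrier G"
  shows "(\<lambda>\<epsilon>\<in>edges. inv\<^bsub>H\<^esub> \<eta> (edge_shift g \<epsilon>), inv g) \<otimes>\<^bsub>K\<^esub> (\<eta>, g) = \<one>\<^bsub>K\<^esub>"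
  using assms by (auto simp: mult_K one_K lamps_apply edge_shift_edge intro!: restrict_ext)

text \<open>\<open>right_convolution\<close> involves inverses in \<open>K\<close>; the group laws
  allow \<open>inv_K\<close> to compute them from left inverses.\<close>

lemma group_K: "group K"
proof (rule groupI)
  show "x \<otimes>\<^bsub>K\<^esub> y \<in> carrier K" if "x \<in> carrier K" "y \<in> carrier K" for x y
    using that by (auto simp: carrier_K mult_K mult_lamps)
  show "\<one>\<^bsub>K\<^esub> \<in> carrier K"
    by (auto simp: carrier_K one_K intro!: lampsI[where S="{}"])
  show "(x \<otimes>\<^bsub>K\<^esub> y) \<otimes>\<^bsub>K\<^esub> z = x \<otimes>\<^bsub>K\<^esub> (y \<otimes>\<^bsub>K\<^esub> z)"
    if "x \<in> carrier K" "y \<in> carrier K" "z \<in> carrier K" for x y z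
    using that
    by (auto simp: carrier_K mult_K m_assoc edge_shift_edge edge_shift_mult inv_mult_group lamps_apply
        H.m_assoc intro!: restrict_ext)
  show "\<one>\<^bsub>K\<^esub> \<otimes>\<^bsub>K\<^esub> x = x" if "x \<in> carrier K" for x
  proof -
    obtain \<eta> g where x: "x = (\<eta>, g)" "\<eta> \<in> lamps" "g \<in> carrier G" using \<open>x \<in> carrier K\<close> by (auto simp: carrier_K)
    have "(\<lambda>\<epsilon>\<in>edges. (\<lambda>\<epsilon>\<in>edges. \<one>\<^bsub>H\<^esub>) \<epsilon> \<otimes>\<^bsub>H\<^esub> \<eta> (edge_shift (inv \<one>) \<epsilon>)) = \<eta>"
      using x mult_lamps[of "\<lambda>\<epsilon>\<in>edges. \<one>\<^bsub>H\<^esub>" \<eta> \<one>] lampsI[where S="{}" and \<eta>="\<lambda>\<epsilon>\<in>edges. \<one>\<^bsub>H\<^esub>"]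
      by (intro lamps_eqI) (auto simp: edge_shift_one lamps_apply)
    then show ?thesis using x by (simp add: one_K mult_K)
  qed
  show "\<exists>y\<in>carrier K. y \<otimes>\<^bsub>K\<^esub> x = \<one>\<^bsub>K\<^esub>" if "x \<in> carrier K" for x
  proof -
    obtain \<eta> g where "x = (\<eta>, g)" "\<eta> \<in> lamps" "g \<in> carrier G" using \<open>x \<in> carrier K\<close> by (auto simp: carrier_K)
    then show ?thesis using left_inverse_K inverse_lamps
      by (intro bexI[of _ "(\<lambda>\<epsilon>\<in>edges. inv\<^bsub>H\<^esub> \<eta> (edge_shift g \<epsilon>), inv g)"]) (auto simp: carrier_K)
  qed
qed

lemma inv_K:
  assumes "\<eta> \<in> lamps" "g \<in> carrier G"
  shows "inv\<^bsub>K\<^esub> (\<eta>, g) = (\<lambda>\<epsilon>\<in>edges. inv\<^bsub>H\<^esub> \<eta> (edge_shift g \<epsilon>), inv g)"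
  using assms left_inverse_K inverse_lamps
  by (intro group.inv_equality[OF group_K]) (auto simp: carrier_K)

section \<open>The law and its convolution operator in coordinates\<close>

abbreviation law :: "(('a set \<Rightarrow> 'h) \<times> 'a) \<Rightarrow> real" where
  "law \<equiv> enlightening_law G H \<mu>"

lemma H_inv_mult_eq_one:
  "a \<in> carrier H \<Longrightarrow> b \<in> carrier H \<Longrightarrow> inv\<^bsub>H\<^esub> a \<otimes>\<^bsub>H\<^esub> b = \<one>\<^bsub>H\<^esub> \<longleftrightarrow> a = b"
  by (metis H.inv_solve_left' H.one_closed H.r_one)

text \<open>Translation by h carries the edge from \<one> to h^-1 h' to the edge {h', h}, so the
  support condition says that the two lamp configurations agree off that edge. Symmetry of \<mu>
  exchanges h and h'.\<close>

lemma law_difference: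
  assumes z: "\<zeta> \<in> lamps" "h \<in> carrier G" and z': "\<zeta>' \<in> lamps" "h' \<in> carrier G"
  shows "law (inv\<^bsub>K\<^esub> (\<zeta>, h) \<otimes>\<^bsub>K\<^esub> (\<zeta>', h')) =
    (if h \<in> nbs h' \<and> (\<forall>\<epsilon>\<in>edges. \<epsilon> \<noteq> {h', h} \<longrightarrow> \<zeta> \<epsilon> = \<zeta>' \<epsilon>)
     then step h' h / real (card (carrier H)) else 0)"
proof -
  let ?d = "\<lambda>\<epsilon>\<in>edges. inv\<^bsub>H\<^esub> \<zeta> (edge_shift h \<epsilon>) \<otimes>\<^bsub>H\<^esub> \<zeta>' (edge_shift h \<epsilon>)"
  have eq: "inv\<^bsub>K\<^esub> (\<zeta>, h) \<otimes>\<^bsub>K\<^esub> (\<zeta>', h') = (?d, inv h \<otimes> h')"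
    using z by (auto simp: inv_K mult_K intro!: restrict_ext)
  have mem: "inv h \<otimes> h' \<in> set_pmf \<mu> \<longleftrightarrow> h \<in> nbs h'"
    using in_nbs[of h h'] z z' step_sym[of h h'] by (simp add: nbs_def)
  have "{\<epsilon> \<in> edges. ?d \<epsilon> \<noteq> \<one>\<^bsub>H\<^esub>} \<subseteq> {{\<one>, inv h \<otimes> h'}} \<longleftrightarrow>
      (\<forall>\<epsilon>\<in>edges. \<zeta> (edge_shift h \<epsilon>) \<noteq> \<zeta>' (edge_shift h \<epsilon>) \<longrightarrow> \<epsilon> = {\<one>, inv h \<otimes> h'})"
    using z z' by (auto simp: H_inv_mult_eq_one lamps_apply edge_shift_edge)
  also have "\<dots> \<longleftrightarrow> (\<forall>\<epsilon>\<in>edges. \<epsilon> \<noteq> {h', h} \<longrightarrow> \<zeta> \<epsilon> = \<zeta>' \<epsilon>)"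
  proof -
    have t: "edge_shift h {\<one>, inv h \<otimes> h'} = {h', h}" "edge_shift (inv h) {h', h} = {\<one>, inv h \<otimes> h'}"
      using z z' by (auto simp: edge_shift_def mult_inv_cancel)
    have there_back: "edge_shift h (edge_shift (inv h) \<epsilon>) = \<epsilon>" "edge_shift (inv h) (edge_shift h \<epsilon>) = \<epsilon>"
      "edge_shift (inv h) \<epsilon> \<in> edges" "edge_shift h \<epsilon> \<in> edges" if "\<epsilon> \<in> edges" for \<epsilon>
      using z that by (auto simp: edge_shift_mult edge_shift_one edge_shift_edge)
    show ?thesis
    proof (intro iffI ballI impI)
      fix \<epsilon> assume "\<forall>\<epsilon>\<in>edges. \<zeta> (edge_shift h \<epsilon>) \<noteq> \<zeta>' (edge_shift h \<epsilon>) \<longrightarrow> \<epsilon> = {\<one>, inv h \<otimes> h'}"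
        "\<epsilon> \<in> edges" "\<epsilon> \<noteq> {h', h}"
      then show "\<zeta> \<epsilon> = \<zeta>' \<epsilon>" using there_back[of \<epsilon>] t by metis
    next
      fix \<epsilon> assume "\<forall>\<epsilon>\<in>edges. \<epsilon> \<noteq> {h', h} \<longrightarrow> \<zeta> \<epsilon> = \<zeta>' \<epsilon>"
        "\<epsilon> \<in> edges" "\<zeta> (edge_shift h \<epsilon>) \<noteq> \<zeta>' (edge_shift h \<epsilon>)"
      then show "\<epsilon> = {\<one>, inv h \<otimes> h'}" using there_back[of \<epsilon>] t by metis
    qed
  qed
  finally have "law (?d, inv h \<otimes> h') =
      (if h \<in> nbs h' \<and> (\<forall>\<epsilon>\<in>edges. \<epsilon> \<noteq> {h', h} \<longrightarrow> \<zeta> \<epsilon> = \<zeta>' \<epsilon>)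
       then step h h' / real (card (carrier H)) else 0)"
    by (simp only: enlightening_law_def prod.case mem step_def)
  then show ?thesis by (simp only: eq step_sym[OF z(2) z'(2)])
qed

lemma lamps_update:
  assumes "\<zeta> \<in> lamps" "\<epsilon> \<in> edges" "a \<in> carrier H" shows "\<zeta>(\<epsilon> := a) \<in> lamps"
  by (rule lampsI[where S="insert \<epsilon> {\<epsilon> \<in> edges. \<zeta> \<epsilon> \<noteq> \<one>\<^bsub>H\<^esub>}"])
    (use assms in \<open>auto simp: in_lamps PiE_iff extensional_def\<close>)

text \<open>The operator averages over the lamp on the traversed edge and takes a step of the walk
  on \<open>G\<close>.\<close>

lemma right_convolution_law:
  assumes z: "\<zeta> \<in> lamps" and x: "x \<in> carrier G"
  shows "right_convolution K law F (\<zeta>, x) =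
    (\<Sum>y\<in>nbs x. step x y * ((\<Sum>a\<in>carrier H. F (\<zeta>({x, y} := a), y)) / real (card (carrier H))))"
proof -
  let ?c = "real (card (carrier H))"
  \<comment> \<open>Only a neighbour y, with the lamp on {x, y} reset to some a, contributes. The
    map is injective, since a can be read off at {x, y}.\<close>
  let ?f = "\<lambda>(y, a). (\<zeta>({x, y} := a), y)"
  let ?t = "\<lambda>y. F y * law (inv\<^bsub>K\<^esub> y \<otimes>\<^bsub>K\<^esub> (\<zeta>, x))"
  have e: "{x, y} \<in> edges" "y \<in> carrier G" if "y \<in> nbs x" for y
    using that edge_if_nbs[OF x] nbs_subset by auto
  have inj: "inj_on ?f (nbs x \<times> carrier H)"
    by (auto simp: inj_on_def dest: fun_upd_eqD)
  have fin: "finite (nbs x \<times> carrier H)" using finite_nbs[OF x] finite_H by simp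
  have "right_convolution K law F (\<zeta>, x) = (\<Sum>\<^sub>\<infinity>y\<in>carrier K. ?t y)"
    by (simp add: right_convolution_def)
  also have "\<dots> = (\<Sum>\<^sub>\<infinity>y\<in>?f ` (nbs x \<times> carrier H). ?t y)"
  proof (rule infsum_cong_neutral)
    fix k assume k: "k \<in> carrier K - ?f ` (nbs x \<times> carrier H)"
    then obtain \<xi> y where y: "k = (\<xi>, y)" "\<xi> \<in> lamps" "y \<in> carrier G" by (auto simp: carrier_K)
    have "\<not> (y \<in> nbs x \<and> (\<forall>\<epsilon>\<in>edges. \<epsilon> \<noteq> {x, y} \<longrightarrow> \<xi> \<epsilon> = \<zeta> \<epsilon>))"
    proof
      assume a: "y \<in> nbs x \<and> (\<forall>\<epsilon>\<in>edges. \<epsilon> \<noteq> {x, y} \<longrightarrow> \<xi> \<epsilon> = \<zeta> \<epsilon>)"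
      then have "\<xi> = \<zeta>({x, y} := \<xi> {x, y})"
        using y z e lamps_apply by (intro lamps_eqI lamps_update) auto
      then have "k = ?f (y, \<xi> {x, y})" using y by simp
      moreover have "\<xi> {x, y} \<in> carrier H" using a y e lamps_apply by blast
      ultimately show False using k a by blast
    qed
    then show "?t k = 0" using y z x by (auto simp: law_difference)
  next
    fix k assume "k \<in> ?f ` (nbs x \<times> carrier H) - carrier K"
    then show "?t k = 0" using e z lamps_update by (auto simp: carrier_K)
  qed simp
  also have "\<dots> = (\<Sum>y\<in>?f ` (nbs x \<times> carrier H). ?t y)" using fin by simp
  also have "\<dots> = (\<Sum>ya\<in>nbs x \<times> carrier H. ?t (?f ya))"
    by (simp add: sum.reindex[OF inj])
  also have "\<dots> = (\<Sum>(y, a)\<in>nbs x \<times> carrier H. F (\<zeta>({x, y} := a), y) * (step x y / ?c))"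
    using e z x lamps_update by (intro sum.cong) (auto simp: law_difference)
  also have "\<dots> = (\<Sum>y\<in>nbs x. \<Sum>a\<in>carrier H. F (\<zeta>({x, y} := a), y) * (step x y / ?c))"
    by (simp add: sum.cartesian_product)
  also have "\<dots> = (\<Sum>y\<in>nbs x. step x y * ((\<Sum>a\<in>carrier H. F (\<zeta>({x, y} := a), y)) / ?c))"
    by (simp add: sum_distrib_left sum_divide_distrib mult_ac)
  finally show ?thesis .
qed

end

section \<open>Averaging over percolation configurations\<close>

context lamplighter
begin

abbreviation c :: real where "c \<equiv> real (card (carrier H))"

abbreviation percolation :: "('a set \<Rightarrow> bool) measure" where
  "percolation \<equiv> bond_percolation G (set_pmf \<mu>) (1 / c)"

lemma c_ge: "c \<ge> 2" using card_H by linarith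

lemma prob_space_percolation: "prob_space percolation"
  unfolding bond_percolation_def by (rule prob_space_PiM) (rule measure_pmf.prob_space_axioms)

lemma measurable_edge: "\<epsilon> \<in> edges \<Longrightarrow> (\<lambda>\<omega>. f (\<omega> \<epsilon>)) \<in> measurable percolation borel"
  unfolding bond_percolation_def
  by (rule measurable_compose[OF measurable_component_singleton]) auto

lemma measurable_walk:
  "x \<in> carrier G \<Longrightarrow> (\<lambda>\<omega>. walk \<omega> n x) \<in> borel_measurable percolation"
proof (induction n arbitrary: x)
  case 0
  then show ?case by simp
next
  case (Suc n)
  then show ?case
    unfolding walk.simps
    by (intro borel_measurable_sum borel_measurable_times measurable_edge edge_if_nbs Suc.IH)
      (use nbs_subset in auto)
qed

text \<open>The matrix entry between \<open>a\<close> and \<open>o\<close> of the averaging projection on functions on \<open>H\<close> is \<open>1 / |H|\<close>, that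
  of the complementary projection is \<open>1 - 1 / |H|\<close> for \<open>a = o\<close> and \<open>- 1 / |H|\<close> otherwise.  The weights
  are these entries divided by the probabilities \<open>1 / |H|\<close> and \<open>1 - 1 / |H|\<close> of an open and a closed edge.\<close>
definition lamp_weight :: "bool \<Rightarrow> 'h \<Rightarrow> real" where
  "lamp_weight b a = (if b \<or> a = \<one>\<^bsub>H\<^esub> then 1 else - 1 / (c - 1))"

definition config_weight :: "('a set \<Rightarrow> bool) \<Rightarrow> ('a set \<Rightarrow> 'h) \<Rightarrow> real" where
  "config_weight \<omega> \<zeta> = (\<Prod>\<epsilon>\<in>{\<epsilon> \<in> edges. \<zeta> \<epsilon> \<noteq> \<one>\<^bsub>H\<^esub>}. lamp_weight (\<omega> \<epsilon>) (\<zeta> \<epsilon>))"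

text \<open>A trivial lamp has weight 1, so extra edges do not change the product.\<close>

lemma config_weight_superset:
  assumes "finite J" "J \<subseteq> edges" "{\<epsilon> \<in> edges. \<zeta> \<epsilon> \<noteq> \<one>\<^bsub>H\<^esub>} \<subseteq> J"
  shows "config_weight \<omega> \<zeta> = (\<Prod>\<epsilon>\<in>J. lamp_weight (\<omega> \<epsilon>) (\<zeta> \<epsilon>))"
  unfolding config_weight_def using assms
  by (intro prod.mono_neutral_left) (auto simp: lamp_weight_def)

lemma lamp_weight_bound: "\<bar>lamp_weight b a\<bar> \<le> 1"
  using c_ge by (auto simp: lamp_weight_def)

lemma config_weight_bound: "\<bar>config_weight \<omega> \<zeta>\<bar> \<le> 1"
  unfolding config_weight_def abs_prod by (intro prod_le_1) (auto simp: lamp_weight_bound)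

lemma measurable_config_weight: "(\<lambda>\<omega>. config_weight \<omega> \<zeta>) \<in> borel_measurable percolation"
  unfolding config_weight_def by (intro borel_measurable_prod measurable_edge) auto

text \<open>For a closed edge the c - 1 nontrivial lamps contribute -1 in total, which cancels the 1
  of the trivial lamp.\<close>

lemma lamp_weight_sum: "(\<Sum>a\<in>carrier H. lamp_weight b a) = (if b then c else 0)"
proof (cases b)
  case False
  have "(\<Sum>a\<in>carrier H. lamp_weight b a) = lamp_weight b \<one>\<^bsub>H\<^esub> + (\<Sum>a\<in>carrier H - {\<one>\<^bsub>H\<^esub>}. lamp_weight b a)"
    using finite_H by (intro sum.remove) auto
  also have "(\<Sum>a\<in>carrier H - {\<one>\<^bsub>H\<^esub>}. lamp_weight b a) = (\<Sum>a\<in>carrier H - {\<one>\<^bsub>H\<^esub>}. - 1 / (c - 1))"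
    using False by (intro sum.cong) (auto simp: lamp_weight_def)
  also have "\<dots> = (c - 1) * (- 1 / (c - 1))"
    using finite_H card_H by (simp add: of_nat_diff)
  finally show ?thesis using False c_ge by (simp add: lamp_weight_def)
qed (simp add: lamp_weight_def)

text \<open>Only the factor at \<epsilon> depends on a. Its average is 1 for an open edge, where the
  factor of \<zeta> is also 1, and 0 for a closed one: averaging a lamp acts as multiplication by
  openness of its edge.\<close>

lemma config_weight_average:
  assumes z: "\<zeta> \<in> lamps" and e: "\<epsilon> \<in> edges"
  shows "(\<Sum>a\<in>carrier H. config_weight \<omega> (\<zeta>(\<epsilon> := a))) / c = (if \<omega> \<epsilon> then config_weight \<omega> \<zeta> else 0)"
proof -
  define J where "J = {\<epsilon> \<in> edges. \<zeta> \<epsilon> \<noteq> \<one>\<^bsub>H\<^esub>} - {\<epsilon>}"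
  define R where "R = (\<Prod>\<epsilon>\<in>J. lamp_weight (\<omega> \<epsilon>) (\<zeta> \<epsilon>))"
  have J: "finite J" "\<epsilon> \<notin> J" using z by (auto simp: J_def lamps_finite_support)
  have R: "config_weight \<omega> \<xi> = lamp_weight (\<omega> \<epsilon>) (\<xi> \<epsilon>) * R" if "\<And>\<delta>. \<delta> \<noteq> \<epsilon> \<Longrightarrow> \<xi> \<delta> = \<zeta> \<delta>" for \<xi>
  proof -
    have "{\<delta> \<in> edges. \<xi> \<delta> \<noteq> \<one>\<^bsub>H\<^esub>} \<subseteq> insert \<epsilon> J"
    proof
      fix \<delta> assume "\<delta> \<in> {\<delta> \<in> edges. \<xi> \<delta> \<noteq> \<one>\<^bsub>H\<^esub>}"
      then show "\<delta> \<in> insert \<epsilon> J" using that[of \<delta>] by (cases "\<delta> = \<epsilon>") (simp_all add: J_def)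
    qed
    then have "config_weight \<omega> \<xi> = (\<Prod>\<delta>\<in>insert \<epsilon> J. lamp_weight (\<omega> \<delta>) (\<xi> \<delta>))"
      using e J by (intro config_weight_superset) (auto simp: J_def)
    also have "\<dots> = lamp_weight (\<omega> \<epsilon>) (\<xi> \<epsilon>) * (\<Prod>\<delta>\<in>J. lamp_weight (\<omega> \<delta>) (\<xi> \<delta>))"
      using J by simp
    also have "(\<Prod>\<delta>\<in>J. lamp_weight (\<omega> \<delta>) (\<xi> \<delta>)) = R"
      unfolding R_def
    proof (rule prod.cong[OF refl])
      fix \<delta> assume "\<delta> \<in> J"
      then have "\<delta> \<noteq> \<epsilon>" using J by auto
      then show "lamp_weight (\<omega> \<delta>) (\<xi> \<delta>) = lamp_weight (\<omega> \<delta>) (\<zeta> \<delta>)" using that[of \<delta>] by simp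
    qed
    finally show ?thesis .
  qed
  have "(\<Sum>a\<in>carrier H. config_weight \<omega> (\<zeta>(\<epsilon> := a))) = (\<Sum>a\<in>carrier H. lamp_weight (\<omega> \<epsilon>) a) * R"
    by (simp add: R sum_distrib_right)
  then have sum: "(\<Sum>a\<in>carrier H. config_weight \<omega> (\<zeta>(\<epsilon> := a))) = (if \<omega> \<epsilon> then c else 0) * R"
    by (simp add: lamp_weight_sum)
  show ?thesis
  proof (cases "\<omega> \<epsilon>")
    case True
    then have "config_weight \<omega> \<zeta> = R" by (simp add: R lamp_weight_def)
    then show ?thesis using True sum c_ge by simp
  qed (simp add: sum)
qed

text \<open>The base case of the induction on n. Factors at different edges are independent and
  centred, so only the empty product has a nonzero expectation.\<close>

lemma config_weight_expectation:
  assumes z: "\<zeta> \<in> lamps"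
  shows "(\<integral>\<omega>. config_weight \<omega> \<zeta> \<partial>percolation) = (if \<zeta> = (\<lambda>\<epsilon>\<in>edges. \<one>\<^bsub>H\<^esub>) then 1 else 0)"
proof -
  define J where "J = {\<epsilon> \<in> edges. \<zeta> \<epsilon> \<noteq> \<one>\<^bsub>H\<^esub>}"
  have J: "finite J" "J \<subseteq> edges" using z by (auto simp: J_def lamps_finite_support)
  let ?b = "measure_pmf (bernoulli_pmf (1 / c))"
  interpret product_prob_space "\<lambda>_. ?b" edges
    by unfold_locales
  have p: "0 \<le> 1 / c" "1 / c \<le> 1" using c_ge by auto
  \<comment> \<open>Here the parameter 1 / c matters: 1 / c - (1 - 1 / c) / (c - 1) = 0.\<close>
  have b: "(\<integral>b. lamp_weight b (\<zeta> \<epsilon>) \<partial>?b) = 0" if "\<epsilon> \<in> J" for \<epsilon>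
    using that p c_ge by (simp add: J_def lamp_weight_def field_simps)
  \<comment> \<open>The integrand is made to factor through the restriction to \<open>J\<close>,
    which reduces the infinite product measure to a finite one.\<close>
  have "(\<integral>\<omega>. config_weight \<omega> \<zeta> \<partial>percolation)
      = (\<integral>\<omega>. (\<Prod>\<epsilon>\<in>J. lamp_weight (restrict \<omega> J \<epsilon>) (\<zeta> \<epsilon>)) \<partial>PiM edges (\<lambda>_. ?b))"
    unfolding config_weight_def J_def[symmetric] bond_percolation_def
    by (intro Bochner_Integration.integral_cong prod.cong) auto
  also have "\<dots> = (\<integral>\<omega>. (\<Prod>\<epsilon>\<in>J. lamp_weight (\<omega> \<epsilon>) (\<zeta> \<epsilon>)) \<partial>distr (PiM edges (\<lambda>_. ?b)) (PiM J (\<lambda>_. ?b)) (\<lambda>\<omega>. restrict \<omega> J))"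
  proof (rule integral_distr[symmetric])
    show "(\<lambda>\<omega>. restrict \<omega> J) \<in> measurable (PiM edges (\<lambda>_. ?b)) (PiM J (\<lambda>_. ?b))"
      by (rule measurable_restrict_subset[OF J(2)])
    show "(\<lambda>\<omega>. \<Prod>\<epsilon>\<in>J. lamp_weight (\<omega> \<epsilon>) (\<zeta> \<epsilon>)) \<in> borel_measurable (PiM J (\<lambda>_. ?b))"
      by (intro borel_measurable_prod measurable_compose[OF measurable_component_singleton]) auto
  qed
  also have "\<dots> = (\<integral>\<omega>. (\<Prod>\<epsilon>\<in>J. lamp_weight (\<omega> \<epsilon>) (\<zeta> \<epsilon>)) \<partial>PiM J (\<lambda>_. ?b))"
    by (simp only: distr_PiM_restrict_finite[OF J])
  also have "\<dots> = (\<Prod>\<epsilon>\<in>J. \<integral>b. lamp_weight b (\<zeta> \<epsilon>) \<partial>?b)"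
    by (rule product_integral_prod[OF J(1)])
      (auto intro!: measure_pmf.integrable_const_bound[where B=1] simp: lamp_weight_bound)
  also have "\<dots> = (if J = {} then 1 else 0)"
    using J(1) b by auto
  also have "J = {} \<longleftrightarrow> \<zeta> = (\<lambda>\<epsilon>\<in>edges. \<one>\<^bsub>H\<^esub>)"
  proof
    assume "J = {}"
    then show "\<zeta> = (\<lambda>\<epsilon>\<in>edges. \<one>\<^bsub>H\<^esub>)"
      using z by (intro lamps_eqI) (auto simp: J_def intro!: lampsI[where S="{}"])
  qed (auto simp: J_def)
  finally show ?thesis .
qed

lemma integrable_walk_weight:
  assumes "x \<in> carrier G"
  shows "integrable percolation (\<lambda>\<omega>. walk \<omega> n x * config_weight \<omega> \<zeta>)"
proof -
  interpret prob_space percolation by (rule prob_space_percolation)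
  have "\<bar>walk \<omega> n x\<bar> * \<bar>config_weight \<omega> \<zeta>\<bar> \<le> 1" for \<omega>
    using mult_mono[OF walk_bound[OF assms] config_weight_bound] by simp
  then show ?thesis
    using measurable_walk[OF assms] measurable_config_weight
    by (intro integrable_const_bound[where B=1]) (auto simp: abs_mult)
qed

text \<open>Only the trivial configuration is wanted in the end, but a step resets the lamp on the
  traversed edge, so the induction runs over all \<zeta> and x. \<open>config_weight_average\<close>
  turns the average over that lamp into the killing factor of \<open>walk\<close>.\<close>

theorem convolution_power_eq_expectation:
  assumes "\<zeta> \<in> lamps" "x \<in> carrier G"
  shows "(right_convolution K law ^^ n) (indicator {\<one>\<^bsub>K\<^esub>}) (\<zeta>, x) =
    (\<integral>\<omega>. walk \<omega> n x * config_weight \<omega> \<zeta> \<partial>percolation)"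
  using assms
proof (induction n arbitrary: \<zeta> x)
  case 0
  then show ?case
    by (auto simp: one_K config_weight_expectation indicator_def)
next
  case (Suc n)
  let ?u = "(right_convolution K law ^^ n) (indicator {\<one>\<^bsub>K\<^esub>})"
  have "(right_convolution K law ^^ Suc n) (indicator {\<one>\<^bsub>K\<^esub>}) (\<zeta>, x)
      = (\<Sum>y\<in>nbs x. step x y * ((\<Sum>a\<in>carrier H. ?u (\<zeta>({x, y} := a), y)) / c))"
    using right_convolution_law[OF Suc.prems] by simp
  also have "\<dots> = (\<Sum>y\<in>nbs x. \<integral>\<omega>. (if \<omega> {x, y} then step x y else 0) * walk \<omega> n y * config_weight \<omega> \<zeta> \<partial>percolation)"
  proof (rule sum.cong[OF refl])
    fix y assume y: "y \<in> nbs x"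
    have e: "{x, y} \<in> edges" and yG: "y \<in> carrier G"
      using y edge_if_nbs Suc.prems nbs_subset by auto
    have "(\<Sum>a\<in>carrier H. ?u (\<zeta>({x, y} := a), y))
        = (\<Sum>a\<in>carrier H. \<integral>\<omega>. walk \<omega> n y * config_weight \<omega> (\<zeta>({x, y} := a)) \<partial>percolation)"
      by (intro sum.cong refl Suc.IH lamps_update Suc.prems e yG)
    also have "\<dots> = (\<integral>\<omega>. (\<Sum>a\<in>carrier H. walk \<omega> n y * config_weight \<omega> (\<zeta>({x, y} := a))) \<partial>percolation)"
      using integrable_walk_weight[OF yG] by simp
    finally have "step x y * ((\<Sum>a\<in>carrier H. ?u (\<zeta>({x, y} := a), y)) / c)
       = (\<integral>\<omega>. step x y * ((\<Sum>a\<in>carrier H. walk \<omega> n y * config_weight \<omega> (\<zeta>({x, y} := a))) / c) \<partial>percolation)"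
      by simp
    also have "\<dots> = (\<integral>\<omega>. (if \<omega> {x, y} then step x y else 0) * walk \<omega> n y * config_weight \<omega> \<zeta> \<partial>percolation)"
    proof (rule Bochner_Integration.integral_cong[OF refl])
      fix \<omega>
      have "(\<Sum>a\<in>carrier H. walk \<omega> n y * config_weight \<omega> (\<zeta>({x, y} := a))) / c
          = walk \<omega> n y * ((\<Sum>a\<in>carrier H. config_weight \<omega> (\<zeta>({x, y} := a))) / c)"
        by (simp add: sum_distrib_left)
      then show "step x y * ((\<Sum>a\<in>carrier H. walk \<omega> n y * config_weight \<omega> (\<zeta>({x, y} := a))) / c)
          = (if \<omega> {x, y} then step x y else 0) * walk \<omega> n y * config_weight \<omega> \<zeta>"
        unfolding config_weight_average[OF Suc.prems(1) e] by simp
    qed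
    finally show "step x y * ((\<Sum>a\<in>carrier H. ?u (\<zeta>({x, y} := a), y)) / c)
       = (\<integral>\<omega>. (if \<omega> {x, y} then step x y else 0) * walk \<omega> n y * config_weight \<omega> \<zeta> \<partial>percolation)" .
  qed
  also have "\<dots> = (\<integral>\<omega>. (\<Sum>y\<in>nbs x. (if \<omega> {x, y} then step x y else 0) * walk \<omega> n y * config_weight \<omega> \<zeta>) \<partial>percolation)"
  proof (rule Bochner_Integration.integral_sum[symmetric])
    fix y assume y: "y \<in> nbs x"
    have e: "{x, y} \<in> edges" and yG: "y \<in> carrier G"
      using y edge_if_nbs Suc.prems nbs_subset by auto
    show "integrable percolation (\<lambda>\<omega>. (if \<omega> {x, y} then step x y else 0) * walk \<omega> n y * config_weight \<omega> \<zeta>)"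
    \<comment> \<open>The integrand is dominated by the integrable product for y times the constant
      \<open>step x y\<close>, which removes the condition on the edge.\<close>
    proof (rule Bochner_Integration.integrable_bound[OF integrable_mult_right[OF integrable_walk_weight[OF yG]], of _ "step x y" n \<zeta>])
      show "(\<lambda>\<omega>. (if \<omega> {x, y} then step x y else 0) * walk \<omega> n y * config_weight \<omega> \<zeta>) \<in> borel_measurable percolation"
        by (intro borel_measurable_times measurable_edge e measurable_walk yG measurable_config_weight)
    qed (auto simp: abs_mult)
  qed
  also have "\<dots> = (\<integral>\<omega>. walk \<omega> (Suc n) x * config_weight \<omega> \<zeta> \<partial>percolation)"
    by (simp add: sum_distrib_right)
  finally show ?case .
qed

text \<open>At the trivial configuration the weight is 1, so the return weights on \<open>K\<close>
  are the expected return weights of the killed walk. The mixture of cluster measures thus witnesses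
  the definite description of the Plancherel measure.\<close>

lemma has_moments_plancherel:
  "has_moments (percolation \<bind> cluster_spectral_measure G \<mu>)
     (\<lambda>n. (right_convolution K law ^^ n) (indicator {\<one>\<^bsub>K\<^esub>}) \<one>\<^bsub>K\<^esub>)"
proof -
  have one: "(\<lambda>\<epsilon>\<in>edges. \<one>\<^bsub>H\<^esub>) \<in> lamps" by (auto intro!: lampsI[where S="{}"])
  have "config_weight \<omega> (\<lambda>\<epsilon>\<in>edges. \<one>\<^bsub>H\<^esub>) = 1" for \<omega>
    by (subst config_weight_superset[where J="{}"]) auto
  then have "(\<lambda>n. \<integral>\<omega>. walk \<omega> n \<one> \<partial>percolation) = (\<lambda>n. (right_convolution K law ^^ n) (indicator {\<one>\<^bsub>K\<^esub>}) \<one>\<^bsub>K\<^esub>)"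
    using convolution_power_eq_expectation[OF one one_closed] by (simp add: one_K)
  then show ?thesis
    using has_moments_bind[OF prob_space_percolation has_moments_cluster_spectral_measure measurable_walk[OF one_closed]]
    by simp
qed

lemma plancherel_measure_eq_bind:
  "plancherel_measure G H \<mu> = percolation \<bind> cluster_spectral_measure G \<mu>"
  unfolding plancherel_measure_def Let_def
  by (rule diagonal_spectral_measure_eqI) (rule has_moments_plancherel)

text \<open>Integrability is part of the claim because the Bochner integral of a non-integrable
  function is 0 by convention; it certifies that the right-hand side is a genuine
  expectation.\<close>

theorem plancherel_measure_eq_expectation:
  assumes B: "B \<in> sets borel"
  shows "integrable percolation (\<lambda>\<omega>. measure (cluster_spectral_measure G \<mu> \<omega>) B)"
    and "measure (plancherel_measure G H \<mu>) B
      = (\<integral>\<omega>. measure (cluster_spectral_measure G \<mu> \<omega>) B \<partial>percolation)"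
proof -
  interpret prob_space percolation by (rule prob_space_percolation)
  have kernel: "cluster_spectral_measure G \<mu> \<in> measurable percolation (subprob_algebra borel)"
    using has_moments_cluster_spectral_measure measurable_walk[OF one_closed]
    by (rule measurable_has_moments_kernel)
  show "measure (plancherel_measure G H \<mu>) B
      = (\<integral>\<omega>. measure (cluster_spectral_measure G \<mu> \<omega>) B \<partial>percolation)"
    unfolding plancherel_measure_eq_bind by (rule measure_bind[OF kernel B])
  have "prob_space (cluster_spectral_measure G \<mu> \<omega>)" for \<omega>
    using has_moments_cluster_spectral_measure by (auto simp: has_moments_def)
  then show "integrable percolation (\<lambda>\<omega>. measure (cluster_spectral_measure G \<mu> \<omega>) B)"
    using measurable_compose[OF kernel measurable_measure_subprob_algebra[OF B]]
    by (intro integrable_const_bound[where B=1]) (auto simp: prob_space.prob_le_1)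
qed

end

theorem mainTheorem10:
  fixes G :: "('a, 'c) monoid_scheme" and H :: "('h, 'd) monoid_scheme" and \<mu> :: "'a pmf"
  assumes "group G"
    and "group H" and "finite (carrier H)" and "card (carrier H) \<ge> 2"
    and "set_pmf \<mu> \<subseteq> carrier G" and "finite (set_pmf \<mu>)"
    and "generate G (set_pmf \<mu>) = carrier G"
    and "\<And>x. x \<in> carrier G \<Longrightarrow> pmf \<mu> (inv\<^bsub>G\<^esub> x) = pmf \<mu> x"
  shows "\<forall>B \<in> sets borel.
    integrable (bond_percolation G (set_pmf \<mu>) (1 / real (card (carrier H))))
      (\<lambda>\<omega>. measure (cluster_spectral_measure G \<mu> \<omega>) B) \<and>
    measure (plancherel_measure G H \<mu>) B =
      (\<integral>\<omega>. measure (cluster_spectral_measure G \<mu> \<omega>) B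
         \<partial>bond_percolation G (set_pmf \<mu>) (1 / real (card (carrier H))))"
proof -
  interpret lamplighter G \<mu> H
    using assms by (simp add: lamplighter_def lamplighter_axioms_def cayley_walk_def cayley_walk_axioms_def)
  show ?thesis using plancherel_measure_eq_expectation by blast
qed

end
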